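(* The problem of deciding, given a multi-digraph $G$, whether $G$ contains a subgraph homeomorphic to the Wheatstone graph $\mathcal W$ can be solved in time polynomial in the size of $G$.
   Context: Graphs are finite; a multi-digraph is a directed graph in which parallel edges are allowed. $\mathcal W$ is the digraph with nodes $a,b,c,d$ and edges $a\to b$, $a\to c$, $b\to c$, $b\to d$, $c\to d$. $G$ contains a subgraph homeomorphic to $\mathcal W$ if there are an injective map $\phi$ from the nodes of $\mathcal W$ to the nodes of $G$ and an injective map $\psi$ assigning to each edge $x\to y$ of $\mathcal W$ a simple directed path of $G$ from $\phi(x)$ to $\phi(y)$, such that the five paths are pairwise node-disjoint except for the endpoints they share as images of common endpoints in $\mathcal W$. The node mapping $\phi$ is not part of the input. *)

theory Defs
  imports "Graph_Theory.Arc_Walk" "HOL-Computational_Algebra.Polynomial"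
begin

section \<open>The Wheatstone graph and subgraph homeomorphism\<close>

datatype wnode = WA | WB | WC | WD

definition wheatstone :: "(wnode, wnode \<times> wnode) pre_digraph" where
  "wheatstone =
     \<lparr> verts = {WA, WB, WC, WD},
       arcs = {(WA, WB), (WA, WC), (WB, WC), (WB, WD), (WC, WD)},
       tail = fst, head = snd \<rparr>"

text \<open>
  Paths are arc lists, so that parallel arcs are told apart. Both \<^term>\<open>\<phi>\<close> and \<^term>\<open>\<psi>\<close> are
  existentially quantified: the node mapping is not part of the input. Since \<^term>\<open>\<phi>\<close> is injective
  and the Wheatstone graph has no loops, the paths are never empty.
\<close>
definition contains_wheatstone :: "('a, 'b) pre_digraph \<Rightarrow> bool" where
  "contains_wheatstone G \<longleftrightarrow>
     (\<exists>(\<phi> :: wnode \<Rightarrow> 'a) (\<psi> :: wnode \<times> wnode \<Rightarrow> 'b list).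
        inj_on \<phi> (verts wheatstone) \<and> \<phi> ` verts wheatstone \<subseteq> verts G \<and>
        inj_on \<psi> (arcs wheatstone) \<and>
        (\<forall>e \<in> arcs wheatstone.
           pre_digraph.apath G (\<phi> (tail wheatstone e)) (\<psi> e) (\<phi> (head wheatstone e))) \<and>
        (\<forall>e \<in> arcs wheatstone. \<forall>f \<in> arcs wheatstone. e \<noteq> f \<longrightarrow>
           set (pre_digraph.awalk_verts G (\<phi> (tail wheatstone e)) (\<psi> e)) \<inter>
           set (pre_digraph.awalk_verts G (\<phi> (tail wheatstone f)) (\<psi> f))
           \<subseteq> \<phi> ` ({tail wheatstone e, head wheatstone e} \<inter> {tail wheatstone f, head wheatstone f})))"


section \<open>Random access machines\<close>

text \<open>
  Polynomial time is defined by the unit-cost random access machine with a read-only input.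
  Registers hold natural numbers and can be addressed indirectly. Addition and truncated
  subtraction are the only arithmetic operations; without multiplication, the length of a register
  grows by at most a constant number of bits per step, and so unit-cost time is polynomially
  equivalent to Turing machine time.
\<close>

datatype instr =
    Const nat nat
  | Add nat nat nat
  | Sub nat nat nat
  | Read nat nat
  | Load nat nat
  | Store nat nat
  | Jump nat
  | JumpZero nat nat

type_synonym program = "instr list"

text \<open>A configuration consists of the program counter and the contents of the registers.\<close>
type_synonym config = "nat \<times> (nat \<Rightarrow> nat)"

fun exec_instr :: "nat list \<Rightarrow> instr \<Rightarrow> config \<Rightarrow> config" where
  "exec_instr w (Const i c) (pc, R) = (Suc pc, R(i := c))"
| "exec_instr w (Add i j k) (pc, R) = (Suc pc, R(i := R j + R k))"
| "exec_instr w (Sub i j k) (pc, R) = (Suc pc, R(i := R j - R k))"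
| "exec_instr w (Read i j) (pc, R) = (Suc pc, R(i := (if R j < length w then w ! R j else 0)))"
| "exec_instr w (Load i j) (pc, R) = (Suc pc, R(i := R (R j)))"
| "exec_instr w (Store i j) (pc, R) = (Suc pc, R(R i := R j))"
| "exec_instr w (Jump l) (pc, R) = (l, R)"
| "exec_instr w (JumpZero i l) (pc, R) = (if R i = 0 then l else Suc pc, R)"

definition halted :: "program \<Rightarrow> config \<Rightarrow> bool" where
  "halted P c \<longleftrightarrow> length P \<le> fst c"

definition step :: "program \<Rightarrow> nat list \<Rightarrow> config \<Rightarrow> config" where
  "step P w c = (if halted P c then c else exec_instr w (P ! fst c) c)"

definition run :: "program \<Rightarrow> nat list \<Rightarrow> nat \<Rightarrow> config" where
  "run P w t = (step P w ^^ t) (0, \<lambda>_. 0)"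

text \<open>
  Registers are initially 0, and the answer is left in register 0 (1 for yes, 0 for no). An instance
  may have several encodings; the program must be correct on each of them.
\<close>
definition decidable_in_poly_time ::
    "'i set \<Rightarrow> ('i \<Rightarrow> nat) \<Rightarrow> ('i \<Rightarrow> nat list set) \<Rightarrow> ('i \<Rightarrow> bool) \<Rightarrow> bool" where
  "decidable_in_poly_time instances size_of encodings Q \<longleftrightarrow>
     (\<exists>(P :: program) (p :: nat poly). \<forall>x \<in> instances. \<forall>w \<in> encodings x.
        \<exists>t \<le> poly p (size_of x).
          halted P (run P w t) \<and> snd (run P w t) 0 = (if Q x then 1 else 0))"


section \<open>Multi-digraphs as inputs\<close>

definition digraph_size :: "('a, 'b) pre_digraph \<Rightarrow> nat" where
  "digraph_size G = card (verts G) + card (arcs G)"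

text \<open>
  An encoding lists the number of nodes, the number of arcs, and then the tail and the head of each
  arc, for an arbitrary numbering \<^term>\<open>\<nu>\<close> of the nodes and an arbitrary order \<^term>\<open>es\<close> of the arcs.
\<close>
definition digraph_encodings :: "('a, 'b) pre_digraph \<Rightarrow> nat list set" where
  "digraph_encodings G =
     {card (verts G) # card (arcs G) # concat (map (\<lambda>e. [\<nu> (tail G e), \<nu> (head G e)]) es) | \<nu> es.
        bij_betw \<nu> (verts G) {..<card (verts G)} \<and> distinct es \<and> set es = arcs G}"

lemma (in fin_digraph) digraph_encodings_nonempty: "digraph_encodings G \<noteq> {}"
proof -
  obtain \<nu> where "bij_betw \<nu> (verts G) {..<card (verts G)}"
    using ex_bij_betw_finite_nat[OF finite_verts] by (auto simp: atLeast0LessThan)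
  moreover obtain es where "distinct es" "set es = arcs G"
    using finite_distinct_list[OF finite_arcs] by blast
  ultimately show ?thesis
    unfolding digraph_encodings_def by blast
qed

end

theory Submission
  imports Defs
begin

text \<open>
  Fix distinct nodes \<open>a\<close> and \<open>d\<close>, delete them, and keep only the nodes that are reachable from a
  successor of \<open>a\<close> and reach a predecessor of \<open>d\<close>. A Wheatstone subgraph with source \<open>a\<close> and sink \<open>d\<close>
  consists of two disjoint paths from successors of \<open>a\<close> to predecessors of \<open>d\<close> and a bridge from one
  to the other. It exists if and only if some weak component of the remaining graph contains two such
  disjoint paths: moving along a weak connection from the first path to the second one, each next
  node still lies on a walk that avoids the second path, or else a bridge has been found. So no two
  paths with prescribed ends have to be disjoint, which would be NP-hard to decide, and by Menger's
  theorem it remains to test whether every single node of the component can be avoided. All these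
  reachability conditions form one system of Horn rules, whose least model is computed by polynomially
  many passes over the arcs.
\<close>

section \<open>Walks in a relation and Menger's theorem for two walks\<close>

text \<open>Only the set of end pairs of the arcs matters: a simple path uses no loop and never two
  parallel arcs. So the graph part works with a plain relation, and arc lists reappear only in the
  translation to \<open>contains_wheatstone\<close>. The middle nodes b and c are never searched
  for. Interchanging the two paths from a to d interchanges b and c, so a bridge in either direction
  will do; this is why a weak component, with directions forgotten, is the right object. The
  component is named by one of its nodes k, and the node x to be avoided is a parameter as well. For
  fixed a, d, k, x all conditions are positive in the derived facts: negation occurs only as
  inequality of nodes, so a least model exists and naive iteration finds it. A single bound N = 4 (n
  + m + 1) serves every loop. It counts the possible facts, four tags on the numbers up to n + m, so
  N passes reach the fixed point; it also exceeds the number of arcs and every node number.\<close>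

definition rwalk :: "('a \<times> 'a) set \<Rightarrow> 'a list \<Rightarrow> bool" where
  "rwalk E p \<longleftrightarrow> p \<noteq> [] \<and> successively (\<lambda>u v. (u, v) \<in> E) p"

lemma rwalk_Nil [simp]: "\<not> rwalk E []"
  by (simp add: rwalk_def)

lemma rwalk_single [simp]: "rwalk E [v]"
  by (simp add: rwalk_def)

lemma rwalk_Cons: "p \<noteq> [] \<Longrightarrow> rwalk E (v # p) \<longleftrightarrow> (v, hd p) \<in> E \<and> rwalk E p"
  by (auto simp: rwalk_def successively_Cons)

lemma rwalk_append:
  "p \<noteq> [] \<Longrightarrow> q \<noteq> [] \<Longrightarrow> rwalk E (p @ q) \<longleftrightarrow> rwalk E p \<and> rwalk E q \<and> (last p, hd q) \<in> E"
  by (auto simp: rwalk_def successively_append_iff)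

lemma rwalk_mono: "rwalk E p \<Longrightarrow> E \<subseteq> E' \<Longrightarrow> rwalk E' p"
  by (auto simp: rwalk_def elim: successively_mono)

lemma rwalk_split:
  assumes "rwalk E (p @ v # q)"
  shows "rwalk E (p @ [v])" "rwalk E (v # q)"
  using assms by (auto simp: rwalk_def successively_append_iff)

lemma rwalk_join:
  assumes "rwalk E p" "rwalk E q" "last p = hd q"
  shows "rwalk E (p @ tl q)" "last (p @ tl q) = last q"
  using assms by (cases q; auto simp: rwalk_def successively_append_iff successively_Cons)+

lemma rwalk_distinct:
  assumes "rwalk E p"
  shows "\<exists>p'. rwalk E p' \<and> distinct p' \<and> hd p' = hd p \<and> last p' = last p \<and> set p' \<subseteq> set p"
  using assms
proof (induction p)
  case (Cons v p)
  show ?case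
  proof (cases "p = []")
    case True
    then show ?thesis by (intro exI[of _ "[v]"]) auto
  next
    case False
    then obtain p' where p': "rwalk E p'" "distinct p'" "hd p' = hd p" "last p' = last p"
        "set p' \<subseteq> set p" "(v, hd p) \<in> E"
      using Cons by (auto simp: rwalk_Cons)
    show ?thesis
    proof (cases "v \<in> set p'")
      case True
      then obtain ys zs where "p' = ys @ v # zs" by (auto dest: split_list)
      with p' False show ?thesis
        by (intro exI[of _ "v # zs"]) (auto dest: rwalk_split)
    next
      case v: False
      have "p' \<noteq> []" using p'(1) by auto
      with p' False v show ?thesis
        by (intro exI[of _ "v # p'"]) (auto simp: rwalk_Cons)
    qed
  qed
qed simp

text \<open>To use the arc (x, y), a walk needs x at a position other than the last and y at a
  position other than the first. The sharp form with \<open>butlast\<close> and \<open>tl\<close>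
  admits walks that end in x or start in y, which is how walks are cut in the Menger
  induction.\<close>

lemma rwalk_insert_cases:
  assumes "rwalk (insert (x, y) E) p" "x \<notin> set (butlast p) \<or> y \<notin> set (tl p)"
  shows "rwalk E p"
  using assms
proof (induction p)
  case (Cons v p)
  show ?case
  proof (cases "p = []")
    case False
    then have "hd p \<in> set p" "set (tl p) \<subseteq> set p" "v = x \<and> hd p = y \<longrightarrow> False"
      using Cons.prems(2) by (auto dest: list.set_sel(2))
    then show ?thesis
      using Cons False by (auto simp: rwalk_Cons)
  qed simp
qed simp

text \<open>The ends range over sets because the Menger induction replaces the sets of ends by
  \<open>{v, x}\<close> and \<open>{v, y}\<close>.\<close>

definition link :: "('a \<times> 'a) set \<Rightarrow> 'a set \<Rightarrow> 'a set \<Rightarrow> 'a list \<Rightarrow> bool" where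
  "link E A D p \<longleftrightarrow> rwalk E p \<and> hd p \<in> A \<and> last p \<in> D"

lemma link_distinct:
  assumes "link E A D p"
  obtains p' where "link E A D p'" "distinct p'" "set p' \<subseteq> set p"
  using rwalk_distinct[of E p] assms unfolding link_def by metis

lemma link_mono: "link E A D p \<Longrightarrow> E \<subseteq> E' \<Longrightarrow> link E' A D p"
  by (auto simp: link_def intro: rwalk_mono)

text \<open>Both decompositions are returned along with the new link, because its use is to show
  that a node occurring only in the discarded parts \<open>p2\<close> and \<open>q1\<close> is
  missed.\<close>

lemma link_through:
  assumes "link E A X p" "link E Y D q" "z \<in> set p" "z \<in> set q"
  obtains p1 p2 q1 q2 where "p = p1 @ z # p2" "q = q1 @ z # q2" "link E A D (p1 @ z # q2)"
proof -
  obtain p1 p2 q1 q2 where *: "p = p1 @ z # p2" "q = q1 @ z # q2"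
    using assms(3,4) by (metis split_list)
  then have "rwalk E (p1 @ [z])" "rwalk E (z # q2)"
    using assms by (auto simp: link_def dest: rwalk_split)
  from rwalk_join[OF this] have "rwalk E (p1 @ z # q2)" by simp
  then have "link E A D (p1 @ z # q2)"
    using * assms(1,2) by (cases p1) (auto simp: link_def)
  with * show ?thesis using that by blast
qed

text \<open>
  Induction on the arcs. If a single node \<open>v\<close> meets all walks that avoid the arc \<open>(x, y)\<close>,
  then no single node separates \<open>A\<close> from \<open>{v, x}\<close>, nor \<open>{v, y}\<close> from \<open>D\<close>, in the smaller
  relation; the walks obtained there are joined at \<open>v\<close> and along \<open>(x, y)\<close>.
\<close>
theorem two_disjoint_links:
  assumes "finite E" "\<And>v. \<exists>p. link E A D p \<and> v \<notin> set p"
  shows "\<exists>p q. link E A D p \<and> link E A D q \<and> set p \<inter> set q = {}"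
  using assms
proof (induction E arbitrary: A D rule: finite_induct)
  case empty
  \<comment> \<open>Without arcs a link is a single node of A and D at once; the hypothesis yields
    two different ones.\<close>
  have *: "\<exists>u. p = [u] \<and> u \<in> A \<and> u \<in> D" if "link {} A D p" for p
    using that by (cases p; cases "tl p") (auto simp: link_def rwalk_def)
  obtain p where "link {} A D p" using empty by blast
  then obtain u where u: "link {} A D [u]" using * by blast
  obtain q where "link {} A D q" "u \<notin> set q" using empty by blast
  with u show ?case by (intro exI[of _ "[u]"] exI[of _ q]) auto
next
  case (insert e E)
  obtain x y where e: "e = (x, y)" by (cases e)
  let ?E = "insert (x, y) E"
  have sub: "E \<subseteq> ?E" by auto
  show ?case
  proof (cases "\<forall>v. \<exists>p. link E A D p \<and> v \<notin> set p")
    case True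
    then show ?thesis using insert.IH[of A D] link_mono sub unfolding e by blast
  next
    case False
    then obtain v where v: "\<And>p. link E A D p \<Longrightarrow> v \<in> set p" by blast
    have left: "\<exists>p. link E A {v, x} p \<and> u \<notin> set p" for u
    proof -
      obtain p where p: "link ?E A D p" "u \<notin> set p" using insert.prems e by blast
      \<comment> \<open>A walk missing x cannot use the new arc, so it is a link of the smaller
        relation and is met by v. Cutting at the first node in \<open>{v, x}\<close> leaves a walk
        of the smaller relation.\<close>
      have "\<exists>z \<in> set p. z \<in> {v, x}"
      proof (rule ccontr)
        assume *: "\<not> ?thesis"
        then have "x \<notin> set (butlast p)" by (auto dest: in_set_butlastD)
        then have "link E A D p" using p by (auto simp: link_def dest: rwalk_insert_cases)
        with v * show False by blast
      qed
      then obtain p1 z p2 where z: "p = p1 @ z # p2" "z \<in> {v, x}" "\<forall>w \<in> set p1. w \<notin> {v, x}"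
        using split_list_first_prop[of p "\<lambda>z. z \<in> {v, x}"] by auto
      have "rwalk ?E (p1 @ [z])" using p z by (auto simp: link_def dest: rwalk_split)
      then have "rwalk E (p1 @ [z])"
        by (rule rwalk_insert_cases) (use z in auto)
      then have "link E A {v, x} (p1 @ [z])"
        using p z by (cases p1) (auto simp: link_def)
      then show ?thesis using p z by (intro exI[of _ "p1 @ [z]"]) auto
    qed
    have right: "\<exists>p. link E {v, y} D p \<and> u \<notin> set p" for u
    proof -
      obtain p where p: "link ?E A D p" "u \<notin> set p" using insert.prems e by blast
      have "\<exists>z \<in> set p. z \<in> {v, y}"
      proof (rule ccontr)
        assume *: "\<not> ?thesis"
        then have "y \<notin> set (tl p)" by (cases p) auto
        then have "link E A D p" using p by (auto simp: link_def dest: rwalk_insert_cases)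
        with v * show False by blast
      qed
      then obtain p1 z p2 where z: "p = p1 @ z # p2" "z \<in> {v, y}" "\<forall>w \<in> set p2. w \<notin> {v, y}"
        using split_list_last_prop[of p "\<lambda>z. z \<in> {v, y}"] by auto
      have "rwalk ?E (z # p2)" using p z by (auto simp: link_def dest: rwalk_split)
      then have "rwalk E (z # p2)"
        by (rule rwalk_insert_cases) (use z in auto)
      then have "link E {v, y} D (z # p2)"
        using p z by (auto simp: link_def)
      then show ?thesis using p z by (intro exI[of _ "z # p2"]) auto
    qed
    have 1: "\<exists>p q. link E A {v} p \<and> link E A {x} q \<and> distinct p \<and> distinct q
        \<and> set p \<inter> set q = {}"
    proof -
      obtain p q where pq: "link E A {v, x} p" "link E A {v, x} q" "set p \<inter> set q = {}"
        using insert.IH[OF left] by blast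
      obtain p' where p': "link E A {v, x} p'" "distinct p'" "set p' \<subseteq> set p"
        using pq link_distinct by metis
      obtain q' where q': "link E A {v, x} q'" "distinct q'" "set q' \<subseteq> set q"
        using pq link_distinct by metis
      have "p' \<noteq> []" "q' \<noteq> []" using p' q' by (auto simp: link_def)
      \<comment> \<open>Disjoint walks have different last nodes, so one of them ends in v and the
        other in x.\<close>
      then have "last p' \<noteq> last q'" using p'(3) q'(3) pq(3) by (metis disjoint_iff last_in_set subsetD)
      then have "link E A {v} p' \<and> link E A {x} q' \<or> link E A {v} q' \<and> link E A {x} p'"
        using p' q' by (auto simp: link_def)
      then show ?thesis using p' q' pq(3) by blast
    qed
    have 2: "\<exists>p q. link E {v} D p \<and> link E {y} D q \<and> distinct p \<and> distinct q
        \<and> set p \<inter> set q = {}"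
    proof -
      obtain p q where pq: "link E {v, y} D p" "link E {v, y} D q" "set p \<inter> set q = {}"
        using insert.IH[OF right] by blast
      obtain p' where p': "link E {v, y} D p'" "distinct p'" "set p' \<subseteq> set p"
        using pq link_distinct by metis
      obtain q' where q': "link E {v, y} D q'" "distinct q'" "set q' \<subseteq> set q"
        using pq link_distinct by metis
      have "p' \<noteq> []" "q' \<noteq> []" using p' q' by (auto simp: link_def)
      then have "hd p' \<noteq> hd q'" using p'(3) q'(3) pq(3) by (metis disjoint_iff hd_in_set subsetD)
      then have "link E {v} D p' \<and> link E {y} D q' \<or> link E {v} D q' \<and> link E {y} D p'"
        using p' q' by (auto simp: link_def)
      then show ?thesis using p' q' pq(3) by blast
    qed
    obtain p1 p2 where p: "link E A {v} p1" "link E A {x} p2" "distinct p1" "distinct p2"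
      "set p1 \<inter> set p2 = {}" using 1 by blast
    obtain q1 q2 where q: "link E {v} D q1" "link E {y} D q2" "distinct q1" "distinct q2"
      "set q1 \<inter> set q2 = {}" using 2 by blast
    have ne: "p1 \<noteq> []" "p2 \<noteq> []" "q1 \<noteq> []" "q2 \<noteq> []"
      using p q by (auto simp: link_def)
    have lp: "last p1 = v" "last p2 = x" "hd q1 = v" "hd q2 = y"
      using p q by (auto simp: link_def)
    have vin: "v \<in> set p1" "v \<in> set q1" using ne lp last_in_set hd_in_set by metis+
    then have vnot: "v \<notin> set p2" "v \<notin> set q2" using p q by auto
    \<comment> \<open>The walk \<open>p1\<close> is simple and has v only at its end, while
      \<open>q2\<close> misses v. A crossing would allow a switch before v is reached, giving a link
      of the smaller relation that misses v. The next claim is the mirror image.\<close>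
    have d1: "set p1 \<inter> set q2 = {}"
    proof (rule ccontr)
      assume "\<not> ?thesis"
      then obtain z where z: "z \<in> set p1" "z \<in> set q2" by blast
      obtain s t s' t' where st: "p1 = s @ z # t" "q2 = s' @ z # t'" "link E A D (s @ z # t')"
        using link_through[OF p(1) q(2) z] by metis
      have "z \<noteq> v" using z vnot by auto
      then have "t \<noteq> []" "last t = v" using st lp by (auto split: if_splits)
      then have "v \<in> set t" by (metis last_in_set)
      then have "v \<notin> set (s @ z # t')" using p(3) st vnot by auto
      then show False using v st by blast
    qed
    have d2: "set q1 \<inter> set p2 = {}"
    proof (rule ccontr)
      assume "\<not> ?thesis"
      then obtain z where z: "z \<in> set p2" "z \<in> set q1" by blast
      obtain s t s' t' where st: "p2 = s @ z # t" "q1 = s' @ z # t'" "link E A D (s @ z # t')"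
        using link_through[OF p(2) q(1) z] by metis
      have "z \<noteq> v" using z vnot by auto
      then have "s' \<noteq> []" "hd s' = v" using st lp by (cases s'; auto)+
      then have "v \<in> set s'" by (metis hd_in_set)
      then have "v \<notin> set (s @ z # t')" using q(3) st vnot by auto
      then show False using v st by blast
    qed
    have "link ?E A D (p1 @ tl q1)"
      using rwalk_join[of E p1 q1] p(1) q(1) ne lp by (auto simp: link_def intro: rwalk_mono)
    moreover have "link ?E A D (p2 @ q2)"
      using p(2) q(2) ne lp by (auto simp: link_def rwalk_append intro: rwalk_mono)
    moreover have "set (tl q1) \<subseteq> set q1" using ne by (cases q1) auto
    then have "set (p1 @ tl q1) \<inter> set (p2 @ q2) = {}"
      using p(5) q(5) d1 d2 by auto
    ultimately show ?thesis unfolding e by blast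
  qed
qed

section \<open>Wheatstone subgraphs with prescribed source and sink\<close>

text \<open>The lists \<open>p\<close> and \<open>q\<close> hold inner nodes only. The bridge
  \<open>r\<close> is left as loose as possible: it may repeat nodes and may run along
  \<open>p\<close> and \<open>q\<close>, and it is trimmed only once, in
  \<open>wheatstone_walks_trim\<close>.\<close>

definition wheatstone_walks ::
    "('a \<times> 'a) set \<Rightarrow> 'a \<Rightarrow> 'a \<Rightarrow> 'a list \<Rightarrow> 'a list \<Rightarrow> 'a list \<Rightarrow> bool" where
  "wheatstone_walks E a d p q r \<longleftrightarrow>
     a \<noteq> d \<and> rwalk E (a # p @ [d]) \<and> rwalk E (a # q @ [d]) \<and> rwalk E r \<and>
     distinct p \<and> distinct q \<and> set p \<inter> set q = {} \<and> {a, d} \<inter> (set p \<union> set q \<union> set r) = {} \<and>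
     hd r \<in> set p \<and> last r \<in> set q"

definition has_wheatstone :: "('a \<times> 'a) set \<Rightarrow> bool" where
  "has_wheatstone E \<longleftrightarrow> (\<exists>a d p q r. wheatstone_walks E a d p q r)"

inductive fwd :: "('a \<times> 'a) set \<Rightarrow> 'a \<Rightarrow> 'a \<Rightarrow> 'a \<Rightarrow> bool" for E a d where
  fwd_start: "(a, v) \<in> E \<Longrightarrow> v \<noteq> a \<Longrightarrow> v \<noteq> d \<Longrightarrow> fwd E a d v"
| fwd_step: "fwd E a d u \<Longrightarrow> (u, v) \<in> E \<Longrightarrow> v \<noteq> a \<Longrightarrow> v \<noteq> d \<Longrightarrow> fwd E a d v"

inductive bwd :: "('a \<times> 'a) set \<Rightarrow> 'a \<Rightarrow> 'a \<Rightarrow> 'a \<Rightarrow> bool" for E a d where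
  bwd_start: "(u, d) \<in> E \<Longrightarrow> u \<noteq> a \<Longrightarrow> u \<noteq> d \<Longrightarrow> bwd E a d u"
| bwd_step: "bwd E a d v \<Longrightarrow> (u, v) \<in> E \<Longrightarrow> u \<noteq> a \<Longrightarrow> u \<noteq> d \<Longrightarrow> bwd E a d u"

text \<open>The weak component of \<open>k\<close> among the nodes that lie both on some walk out of \<open>a\<close> and on some
  walk into \<open>d\<close>.\<close>
inductive wcomp :: "('a \<times> 'a) set \<Rightarrow> 'a \<Rightarrow> 'a \<Rightarrow> 'a \<Rightarrow> 'a \<Rightarrow> bool" for E a d k where
  wcomp_start: "fwd E a d k \<Longrightarrow> bwd E a d k \<Longrightarrow> wcomp E a d k k"
| wcomp_out: "wcomp E a d k u \<Longrightarrow> (u, v) \<in> E \<Longrightarrow> fwd E a d v \<Longrightarrow> bwd E a d v \<Longrightarrow> wcomp E a d k v"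
| wcomp_in: "wcomp E a d k v \<Longrightarrow> (u, v) \<in> E \<Longrightarrow> fwd E a d u \<Longrightarrow> bwd E a d u \<Longrightarrow> wcomp E a d k u"

text \<open>Success is recorded at d itself, so a single fact has to be queried. The rule
  \<open>avoid_end\<close> does not compare d with x, and a is never entered, so queries with x
  equal to a or d are harmless and x may range over all nodes.\<close>

inductive reach_avoid :: "('a \<times> 'a) set \<Rightarrow> 'a \<Rightarrow> 'a \<Rightarrow> 'a \<Rightarrow> 'a \<Rightarrow> 'a \<Rightarrow> bool" for E a d k x where
  avoid_start: "(a, v) \<in> E \<Longrightarrow> wcomp E a d k v \<Longrightarrow> v \<noteq> x \<Longrightarrow> reach_avoid E a d k x v"
| avoid_step: "reach_avoid E a d k x u \<Longrightarrow> (u, v) \<in> E \<Longrightarrow> wcomp E a d k v \<Longrightarrow> v \<noteq> x \<Longrightarrow>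
    reach_avoid E a d k x v"
| avoid_end: "reach_avoid E a d k x u \<Longrightarrow> (u, d) \<in> E \<Longrightarrow> a \<noteq> d \<Longrightarrow> reach_avoid E a d k x d"

section \<open>From a Wheatstone configuration to the reachability conditions\<close>

lemma fwd_walk:
  "rwalk E p \<Longrightarrow> (a, hd p) \<in> E \<or> fwd E a d (hd p) \<Longrightarrow> {a, d} \<inter> set p = {} \<Longrightarrow> v \<in> set p \<Longrightarrow>
   fwd E a d v"
proof (induction p)
  case (Cons u p)
  have u: "fwd E a d u" using Cons.prems by (auto intro: fwd_start)
  show ?case
  proof (cases "p = []")
    case False
    then have "fwd E a d (hd p)" using Cons.prems u by (cases p) (auto simp: rwalk_Cons intro: fwd_step)
    then show ?thesis using Cons u False by (auto simp: rwalk_Cons)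
  qed (use Cons u in auto)
qed simp

lemma bwd_walk:
  "rwalk E p \<Longrightarrow> (last p, d) \<in> E \<or> bwd E a d (last p) \<Longrightarrow> {a, d} \<inter> set p = {} \<Longrightarrow> v \<in> set p \<Longrightarrow>
   bwd E a d v"
proof (induction p arbitrary: v)
  case (Cons u p)
  show ?case
  proof (cases "p = []")
    case False
    then have *: "bwd E a d w" if "w \<in> set p" for w using Cons that by (auto simp: rwalk_Cons)
    have "bwd E a d u" using Cons.prems(1,3) False * bwd_step[of E a d "hd p" u] by (auto simp: rwalk_Cons)
    then show ?thesis using Cons.prems * by auto
  qed (use Cons.prems in \<open>auto intro: bwd_start\<close>)
qed simp

text \<open>Membership spreads from one node of the walk both forwards and backwards, because the
  component ignores the direction of arcs.\<close>

lemma wcomp_walk: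
  "rwalk E p \<Longrightarrow> \<forall>w \<in> set p. fwd E a d w \<and> bwd E a d w \<Longrightarrow> w \<in> set p \<Longrightarrow> wcomp E a d k w \<Longrightarrow>
   v \<in> set p \<Longrightarrow> wcomp E a d k v"
proof (induction p arbitrary: v w)
  case (Cons u p)
  show ?case
  proof (cases "p = []")
    case False
    then have p: "rwalk E p" "(u, hd p) \<in> E" "hd p \<in> set p" using Cons.prems by (auto simp: rwalk_Cons)
    have "\<exists>w \<in> set p. wcomp E a d k w"
      using Cons.prems p by (cases "w = u") (auto intro: wcomp_out)
    then obtain w' where "w' \<in> set p" "wcomp E a d k w'" by blast
    then have *: "wcomp E a d k z" if "z \<in> set p" for z
      using Cons.IH[of w' z] Cons.prems(2) p that by simp
    have "wcomp E a d k u" using Cons.prems(2) p *[of "hd p"] wcomp_in[of E a d k "hd p" u] by simp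
    with * Cons.prems show ?thesis by auto
  qed (use Cons.prems in auto)
qed simp

lemma reach_avoid_walk:
  "rwalk E p \<Longrightarrow> (a, hd p) \<in> E \<or> reach_avoid E a d k x (hd p) \<Longrightarrow> \<forall>w \<in> set p. wcomp E a d k w \<Longrightarrow>
   x \<notin> set p \<Longrightarrow> v \<in> set p \<Longrightarrow> reach_avoid E a d k x v"
proof (induction p)
  case (Cons u p)
  have u: "reach_avoid E a d k x u" using Cons.prems by (auto intro: avoid_start)
  show ?case
  proof (cases "p = []")
    case False
    then have "reach_avoid E a d k x (hd p)"
      using Cons.prems u by (cases p) (auto simp: rwalk_Cons intro: avoid_step)
    then show ?thesis using Cons u False by (auto simp: rwalk_Cons)
  qed (use Cons u in auto)
qed simp

lemma rwalk_between:
  assumes "p \<noteq> []"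
  shows "rwalk E (a # p @ [d]) \<longleftrightarrow> rwalk E p \<and> (a, hd p) \<in> E \<and> (last p, d) \<in> E"
  using assms by (auto simp: rwalk_Cons rwalk_append)

text \<open>The bridge puts \<open>p\<close> and \<open>q\<close> into one component, named here by
  the first node of \<open>r\<close>. Since \<open>p\<close> and \<open>q\<close> are disjoint, x
  misses one of them, and that one leads to d.\<close>

lemma wheatstone_walks_reach_avoid:
  assumes "wheatstone_walks E a d p q r"
  shows "reach_avoid E a d (hd r) x d"
proof -
  have ne: "p \<noteq> []" "q \<noteq> []" "r \<noteq> []" and "a \<noteq> d"
    using assms by (auto simp: wheatstone_walks_def)
  have p: "rwalk E p" "(a, hd p) \<in> E" "(last p, d) \<in> E"
    and q: "rwalk E q" "(a, hd q) \<in> E" "(last q, d) \<in> E"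
    and r: "rwalk E r" "hd r \<in> set p" "last r \<in> set q"
    and dis: "{a, d} \<inter> set p = {}" "{a, d} \<inter> set q = {}" "{a, d} \<inter> set r = {}"
      "set p \<inter> set q = {}"
    using assms ne by (auto simp: wheatstone_walks_def rwalk_between)
  have fb: "\<forall>w \<in> set p. fwd E a d w \<and> bwd E a d w" "\<forall>w \<in> set q. fwd E a d w \<and> bwd E a d w"
    using fwd_walk[OF p(1), of a d] bwd_walk[OF p(1), of d a]
      fwd_walk[OF q(1), of a d] bwd_walk[OF q(1), of d a] p q dis by blast+
  \<comment> \<open>The bridge inherits reachability from a through its start on \<open>p\<close>,
    and access to d through its end on \<open>q\<close>.\<close>
  have "fwd E a d (hd r)" "bwd E a d (last r)" using fb r by auto
  then have "\<forall>w \<in> set r. fwd E a d w \<and> bwd E a d w"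
    using fwd_walk[OF r(1), of a d] bwd_walk[OF r(1), of d a] dis(3) by simp
  moreover have "wcomp E a d (hd r) (hd r)"
    using fb r by (auto intro: wcomp_start)
  ultimately have "\<forall>w \<in> set r. wcomp E a d (hd r) w"
    using wcomp_walk[OF r(1), of a d "hd r"] ne by auto
  then have "wcomp E a d (hd r) (hd r)" "wcomp E a d (hd r) (last r)" using ne by simp_all
  then have "\<forall>w \<in> set p. wcomp E a d (hd r) w" "\<forall>w \<in> set q. wcomp E a d (hd r) w"
    using wcomp_walk[OF p(1) fb(1) r(2)] wcomp_walk[OF q(1) fb(2) r(3)] by simp_all
  moreover have "x \<notin> set p \<or> x \<notin> set q" using dis by blast
  ultimately have "reach_avoid E a d (hd r) x (last p) \<or> reach_avoid E a d (hd r) x (last q)"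
    using reach_avoid_walk[OF p(1), of a d "hd r" x "last p"]
      reach_avoid_walk[OF q(1), of a d "hd r" x "last q"] p(2) q(2) ne by (elim disjE) simp_all
  with p q \<open>a \<noteq> d\<close> show ?thesis by (auto intro: avoid_end)
qed

section \<open>From avoidability back to a Wheatstone configuration\<close>

lemma fwd_inner: "fwd E a d v \<Longrightarrow> v \<noteq> a \<and> v \<noteq> d"
  by (induction rule: fwd.induct) auto

lemma wcomp_fwd_bwd: "wcomp E a d k v \<Longrightarrow> fwd E a d v \<and> bwd E a d v"
  by (induction rule: wcomp.induct) auto

lemma fwd_obtain:
  assumes "fwd E a d v"
  obtains s where "rwalk E s" "(a, hd s) \<in> E" "last s = v" "{a, d} \<inter> set s = {}"
proof -
  have "\<exists>s. rwalk E s \<and> (a, hd s) \<in> E \<and> last s = v \<and> {a, d} \<inter> set s = {}"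
    using assms
  proof induction
    case (fwd_start v)
    then show ?case by (intro exI[of _ "[v]"]) auto
  next
    case (fwd_step u v)
    then obtain s where s: "rwalk E s" "(a, hd s) \<in> E" "last s = u" "{a, d} \<inter> set s = {}" by blast
    then have "s \<noteq> []" by auto
    with s fwd_step show ?case by (intro exI[of _ "s @ [v]"]) (auto simp: rwalk_append)
  qed
  then show ?thesis using that by blast
qed

lemma bwd_obtain:
  assumes "bwd E a d v"
  obtains s where "rwalk E s" "(last s, d) \<in> E" "hd s = v" "{a, d} \<inter> set s = {}"
proof -
  have "\<exists>s. rwalk E s \<and> (last s, d) \<in> E \<and> hd s = v \<and> {a, d} \<inter> set s = {}"
    using assms
  proof induction
    case (bwd_start v)
    then show ?case by (intro exI[of _ "[v]"]) auto
  next
    case (bwd_step v u)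
    then obtain s where s: "rwalk E s" "(last s, d) \<in> E" "hd s = v" "{a, d} \<inter> set s = {}" by blast
    then have "s \<noteq> []" by auto
    with s bwd_step show ?case by (intro exI[of _ "u # s"]) (auto simp: rwalk_Cons)
  qed
  then show ?thesis using that by blast
qed

lemma reach_avoid_link:
  fixes E a d k
  defines "K \<equiv> {(u, v) \<in> E. wcomp E a d k u \<and> wcomp E a d k v}"
    and "A \<equiv> {v. wcomp E a d k v \<and> (a, v) \<in> E}" and "D \<equiv> {u. wcomp E a d k u \<and> (u, d) \<in> E}"
  assumes "reach_avoid E a d k x d"
  shows "\<exists>p. link K A D p \<and> x \<notin> set p"
proof -
  let ?W = "\<exists>p. link K A D p \<and> x \<notin> set p"
  \<comment> \<open>After d has been reached the rules may continue out of d. By then the desired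
    link exists, so \<open>?W\<close> is carried along as an alternative. For the node d itself only
    \<open>?W\<close> remains, because d lies outside the component.\<close>
  have "?W \<or> wcomp E a d k v \<and> (\<exists>p. rwalk K p \<and> hd p \<in> A \<and> last p = v \<and> x \<notin> set p)"
    if "reach_avoid E a d k x v" for v
    using that
  proof induction
    case (avoid_start v)
    then have "rwalk K [v] \<and> hd [v] \<in> A \<and> last [v] = v \<and> x \<notin> set [v]" by (auto simp: A_def)
    with avoid_start show ?case by blast
  next
    case (avoid_step u v)
    show ?case
    proof (cases ?W)
      case False
      with avoid_step obtain p where p: "rwalk K p" "hd p \<in> A" "last p = u" "x \<notin> set p"
        and u: "wcomp E a d k u" by blast
      have "p \<noteq> []" using p by auto
      with p u avoid_step have "rwalk K (p @ [v]) \<and> hd (p @ [v]) \<in> A \<and> last (p @ [v]) = v \<and> x \<notin> set (p @ [v])"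
        by (auto simp: rwalk_append K_def)
      with avoid_step show ?thesis by blast
    qed simp
  next
    case (avoid_end u)
    then show ?case unfolding link_def D_def by blast
  qed
  from this[OF assms(4)] show ?thesis
    using wcomp_fwd_bwd fwd_inner by metis
qed

text \<open>If the bridge runs from \<open>q\<close> to \<open>p\<close>, the two paths swap roles.
  On the side of \<open>p\<close> the bridge is attached to the first or the last node, which
  survives when \<open>p\<close> is made simple.\<close>

lemma wheatstone_of_bridge:
  assumes p: "rwalk E p" "(a, hd p) \<in> E" "(last p, d) \<in> E" "{a, d} \<inter> set p = {}"
    and q: "rwalk E q" "(a, hd q) \<in> E" "(last q, d) \<in> E" "{a, d} \<inter> set q = {}" "distinct q"
    and "set p \<inter> set q = {}" "a \<noteq> d"
    and r: "rwalk E r" "{a, d} \<inter> set r = {}"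
      "hd r = hd p \<and> last r \<in> set q \<or> hd r \<in> set q \<and> last r = last p"
  shows "has_wheatstone E"
proof -
  obtain p' where p': "rwalk E p'" "distinct p'" "hd p' = hd p" "last p' = last p" "set p' \<subseteq> set p"
    using rwalk_distinct[OF p(1)] by blast
  have ne: "p' \<noteq> []" "q \<noteq> []" using p' q by auto
  then have "hd p' \<in> set p'" "last p' \<in> set p'" by auto
  then have "wheatstone_walks E a d p' q r \<or> wheatstone_walks E a d q p' r"
    unfolding wheatstone_walks_def rwalk_between[OF ne(1)] rwalk_between[OF ne(2)]
    using assms p' by auto
  then show ?thesis unfolding has_wheatstone_def by blast
qed

text \<open>
  Let \<open>q\<close> be one of two disjoint links. Nodes on walks from \<open>a\<close> to \<open>d\<close> that avoid \<open>q\<close> are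
  adjacent only to such nodes: otherwise the extended walk runs into \<open>q\<close> and bridges the two links.
\<close>
lemma wheatstone_or_avoiding_neighbour:
  fixes E a d q
  defines "S \<equiv> \<lambda>v. \<exists>p. rwalk E p \<and> (a, hd p) \<in> E \<and> (last p, d) \<in> E \<and> v \<in> set p \<and>
    {a, d} \<inter> set p = {} \<and> set p \<inter> set q = {}"
  assumes q: "rwalk E q" "(a, hd q) \<in> E" "(last q, d) \<in> E" "{a, d} \<inter> set q = {}" "distinct q"
    and "a \<noteq> d"
    and v: "S v" and w: "(v, w) \<in> E \<or> (w, v) \<in> E" "fwd E a d w" "bwd E a d w"
  shows "has_wheatstone E \<or> S w"
proof -
  obtain p where p: "rwalk E p" "(a, hd p) \<in> E" "(last p, d) \<in> E" "v \<in> set p"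
    "{a, d} \<inter> set p = {}" "set p \<inter> set q = {}" using v unfolding S_def by blast
  then obtain p1 p2 where p12: "p = p1 @ v # p2" by (auto dest: split_list)
  have p12w: "rwalk E (p1 @ [v])" "rwalk E (v # p2)" using p p12 by (auto dest: rwalk_split)
  have hl: "hd (p1 @ [v]) = hd p" "last (v # p2) = last p" using p12 by (cases p1; auto)+
  note bridge = wheatstone_of_bridge[OF p(1,2,3,5) q p(6) \<open>a \<noteq> d\<close>]
  show ?thesis
  proof (cases "(v, w) \<in> E")
    case True
    obtain s where s: "rwalk E s" "(last s, d) \<in> E" "hd s = w" "{a, d} \<inter> set s = {}"
      using bwd_obtain[OF w(3)] by blast
    have s0: "s \<noteq> []" using s by auto
    show ?thesis
    proof (cases "set s \<inter> set q = {}")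
      case False
      then obtain s1 y s2 where y: "s = s1 @ y # s2" "y \<in> set q" by (metis disjoint_iff split_list)
      have "rwalk E (s1 @ [y])" using s y by (auto dest: rwalk_split)
      moreover have "hd (s1 @ [y]) = w" using s y by (cases s1) auto
      \<comment> \<open>The bridge starts at the first node of \<open>p\<close>, follows
        \<open>p\<close> up to v and only then leaves towards y on \<open>q\<close>. Its overlap
        with \<open>p\<close> is permitted.\<close>
      ultimately have "rwalk E ((p1 @ [v]) @ (s1 @ [y]))"
        using p12w True by (subst rwalk_append) auto
      then have "has_wheatstone E"
        by (rule bridge) (use s y p p12 hl in \<open>auto simp: hd_append split: if_splits\<close>)
      then show ?thesis ..
    next
      case dis: True
      have "rwalk E ((p1 @ [v]) @ s)" using p12w s s0 True by (subst rwalk_append) auto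
      moreover have "w \<in> set s" using s s0 hd_in_set by metis
      ultimately have "S w" unfolding S_def
        using s s0 p p12 hl dis by (intro exI[of _ "(p1 @ [v]) @ s"]) (cases p1; auto)
      then show ?thesis ..
    qed
  next
    case False
    then have wv: "(w, v) \<in> E" using w by blast
    obtain s where s: "rwalk E s" "(a, hd s) \<in> E" "last s = w" "{a, d} \<inter> set s = {}"
      using fwd_obtain[OF w(2)] by blast
    have s0: "s \<noteq> []" using s by auto
    show ?thesis
    proof (cases "set s \<inter> set q = {}")
      case False
      then obtain s1 y s2 where y: "s = s1 @ y # s2" "y \<in> set q" by (metis disjoint_iff split_list)
      have "rwalk E (y # s2)" using s y by (auto dest: rwalk_split)
      moreover have "last (y # s2) = w" using s y by auto
      ultimately have "rwalk E ((y # s2) @ (v # p2))"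
        using p12w wv by (subst rwalk_append) auto
      then have "has_wheatstone E"
        by (rule bridge) (use s y p p12 hl in auto)
      then show ?thesis ..
    next
      case dis: True
      have "rwalk E (s @ v # p2)" using p12w s s0 wv by (subst rwalk_append) auto
      moreover have "w \<in> set s" using s s0 last_in_set by metis
      ultimately have "S w" unfolding S_def
        using s s0 p p12 hl dis by (intro exI[of _ "s @ v # p2"]) auto
      then show ?thesis ..
    qed
  qed
qed

lemma reach_avoid_wheatstone:
  assumes "finite E" and avoid: "\<And>x. reach_avoid E a d k x d"
  shows "has_wheatstone E"
proof (rule ccontr)
  assume no: "\<not> ?thesis"
  let ?C = "wcomp E a d k"
  let ?K = "{(u, v) \<in> E. ?C u \<and> ?C v}"
  let ?A = "{v. ?C v \<and> (a, v) \<in> E}" and ?D = "{u. ?C u \<and> (u, d) \<in> E}"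
  have inner: "v \<noteq> a" "v \<noteq> d" if "?C v" for v using that wcomp_fwd_bwd fwd_inner by metis+
  \<comment> \<open>As d lies outside the component, the fact about d can only stem from
    \<open>avoid_end\<close>, which carries the inequality.\<close>
  have "a \<noteq> d" using avoid[of a] inner by (cases) auto
  have "finite ?K" using assms(1) by (rule rev_finite_subset) auto
  then obtain p' q' where pq': "link ?K ?A ?D p'" "link ?K ?A ?D q'" "set p' \<inter> set q' = {}"
    using two_disjoint_links[of ?K ?A ?D] reach_avoid_link[OF avoid] by blast
  obtain q where q: "link ?K ?A ?D q" "distinct q" "set q \<subseteq> set q'"
    using link_distinct[OF pq'(2)] by blast
  have in_comp: "set s \<subseteq> Collect ?C" if "rwalk ?K s" "?C (hd s)" for s
    using that
  proof (induction s)
    case (Cons u s)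
    then show ?case by (cases "s = []") (auto simp: rwalk_Cons)
  qed simp
  have pC: "set p' \<subseteq> Collect ?C" and qC: "set q \<subseteq> Collect ?C"
    using in_comp pq' q by (auto simp: link_def)
  define S where "S = (\<lambda>v. \<exists>p. rwalk E p \<and> (a, hd p) \<in> E \<and> (last p, d) \<in> E \<and> v \<in> set p \<and>
    {a, d} \<inter> set p = {} \<and> set p \<inter> set q = {})"
  have KE: "?K \<subseteq> E" by auto
  have q': "rwalk E q" "(a, hd q) \<in> E" "(last q, d) \<in> E" "{a, d} \<inter> set q = {}"
    using q qC inner rwalk_mono[OF _ KE] unfolding link_def by blast+
  have neighbour: "S w" if "S v" "(v, w) \<in> E \<or> (w, v) \<in> E" "?C w" for v w
    using wheatstone_or_avoiding_neighbour[OF q' q(2) \<open>a \<noteq> d\<close>] that no wcomp_fwd_bwd[OF that(3)]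
    unfolding S_def by blast
  \<comment> \<open>Stated as an equivalence with k, the property travels from the first node of
    \<open>p'\<close> to k and on to the first node of \<open>q\<close>. There it is absurd, because
    its witness would have to avoid \<open>q\<close>.\<close>
  have "?C v \<and> (S v \<longleftrightarrow> S k)" if "?C v" for v
    using that
  proof induction
    case wcomp_start
    then show ?case by (auto intro: wcomp.wcomp_start)
  next
    case (wcomp_out u v)
    then have "?C v" by (blast intro: wcomp.wcomp_out)
    with wcomp_out neighbour show ?case by blast
  next
    case (wcomp_in v u)
    then have "?C u" by (blast intro: wcomp.wcomp_in)
    with wcomp_in neighbour show ?case by blast
  qed
  moreover have "?C (hd p')" "?C (hd q)" using pq' q by (auto simp: link_def)
  moreover have "rwalk E p' \<and> (a, hd p') \<in> E \<and> (last p', d) \<in> E \<and> hd p' \<in> set p' \<and>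
      {a, d} \<inter> set p' = {} \<and> set p' \<inter> set q = {}"
    using pq' q(3) pC inner rwalk_mono[OF _ KE] by (cases p') (auto simp: link_def)
  then have "S (hd p')" unfolding S_def by blast
  ultimately have "S (hd q)" by blast
  moreover have "hd q \<in> set q" using q by (cases q) (auto simp: link_def)
  ultimately show False unfolding S_def by blast
qed

theorem has_wheatstone_iff_reach_avoid:
  assumes "finite E"
  shows "has_wheatstone E \<longleftrightarrow> (\<exists>a d k. \<forall>x. reach_avoid E a d k x d)"
proof
  assume "has_wheatstone E"
  then obtain a d p q r where "wheatstone_walks E a d p q r" by (auto simp: has_wheatstone_def)
  then have "\<forall>x. reach_avoid E a d (hd r) x d" using wheatstone_walks_reach_avoid by fast
  then show "\<exists>a d k. \<forall>x. reach_avoid E a d k x d" by blast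
qed (use reach_avoid_wheatstone[OF assms] in blast)

section \<open>Subgraphs homeomorphic to the Wheatstone graph\<close>

text \<open>Cut the simple version of the bridge at its first node c on \<open>q\<close>, and then
  at the last node b on \<open>p\<close> before c: what lies between them meets neither
  path.\<close>

lemma wheatstone_walks_trim:
  assumes "wheatstone_walks E a d p q r"
  obtains b c p1 p2 q1 q2 m where
    "rwalk E (a # p1 @ [b])" "rwalk E (a # q1 @ [c])" "rwalk E (b # m @ [c])"
    "rwalk E (b # p2 @ [d])" "rwalk E (c # q2 @ [d])"
    "distinct ([a, b, c, d] @ p1 @ q1 @ m @ p2 @ q2)"
proof -
  have W: "rwalk E (a # p @ [d])" "rwalk E (a # q @ [d])" "rwalk E r" "distinct p" "distinct q"
    "set p \<inter> set q = {}" "a \<noteq> d" "{a, d} \<inter> (set p \<union> set q \<union> set r) = {}"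
    "hd r \<in> set p" "last r \<in> set q"
    using assms by (auto simp: wheatstone_walks_def)
  obtain r' where r': "rwalk E r'" "distinct r'" "hd r' = hd r" "last r' = last r" "set r' \<subseteq> set r"
    using rwalk_distinct[OF W(3)] by blast
  have "r' \<noteq> []" using r' by auto
  then have "last r' \<in> set r'" "hd r' \<in> set r'" by auto
  then have "\<exists>z \<in> set r'. z \<in> set q" using r' W by auto
  then obtain s c t where c: "r' = s @ c # t" "c \<in> set q" "\<forall>w \<in> set s. w \<notin> set q"
    using split_list_first_prop[of r' "\<lambda>z. z \<in> set q"] by blast
  \<comment> \<open>The bridge starts on \<open>p\<close>, hence not on \<open>q\<close>, so c is
    not its first node.\<close>
  have s: "s \<noteq> []" "hd s \<in> set p"
    using c r' W by (cases s; auto)+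
  then have "\<exists>z \<in> set s. z \<in> set p" using hd_in_set by blast
  then obtain s1 b m where b: "s = s1 @ b # m" "b \<in> set p" "\<forall>w \<in> set m. w \<notin> set p"
    using split_list_last_prop[of s "\<lambda>z. z \<in> set p"] by blast
  obtain p1 p2 where p: "p = p1 @ b # p2" using b by (auto dest: split_list)
  obtain q1 q2 where q: "q = q1 @ c # q2" using c by (auto dest: split_list)
  have "rwalk E ((s1 @ b # m) @ [c])" using r' c b rwalk_split(1)[of E s c t] by simp
  then have m: "rwalk E (b # m @ [c])" using rwalk_split(2)[of E s1 b "m @ [c]"] by simp
  have p12: "rwalk E (a # p1 @ [b])" "rwalk E (b # p2 @ [d])"
    using W(1) p rwalk_split[of E "a # p1" b "p2 @ [d]"] by simp_all
  have q12: "rwalk E (a # q1 @ [c])" "rwalk E (c # q2 @ [d])"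
    using W(2) q rwalk_split[of E "a # q1" c "q2 @ [d]"] by simp_all
  have "set m \<subseteq> set r" using r' c b by auto
  moreover have "set m \<inter> set p = {}" "set m \<inter> set q = {}" "distinct m" using b c r' by auto
  ultimately have "distinct ([a, b, c, d] @ p1 @ q1 @ m @ p2 @ q2)"
    using W p q by auto
  then show ?thesis by (rule that[OF p12(1) q12(1) m p12(2) q12(2)])
qed

context wf_digraph
begin

lemma rwalk_awalk_verts: "awalk u es v \<Longrightarrow> rwalk (arcs_ends G) (awalk_verts u es)"
proof (induction es arbitrary: u)
  case (Cons e es)
  then have "awalk (head G e) es v" "e \<in> arcs G" by (auto simp: awalk_Cons_iff)
  moreover from this have "hd (awalk_verts (head G e) es) = head G e" by auto
  ultimately show ?case
    using Cons.IH by (auto simp: rwalk_Cons arcs_ends_def arc_to_ends_def)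
qed simp

lemma rwalk_obtain_awalk:
  assumes "rwalk (arcs_ends G) p" "set p \<subseteq> verts G"
  shows "\<exists>es. awalk (hd p) es (last p) \<and> awalk_verts (hd p) es = p"
  using assms
proof (induction p)
  case (Cons u p)
  show ?case
  proof (cases "p = []")
    case True
    then show ?thesis using Cons.prems by (intro exI[of _ "[]"]) (auto simp: awalk_Nil_iff)
  next
    case False
    then obtain es where es: "awalk (hd p) es (last p)" "awalk_verts (hd p) es = p"
      using Cons by (auto simp: rwalk_Cons)
    obtain e where e: "e \<in> arcs G" "tail G e = u" "head G e = hd p"
      using Cons.prems False by (auto simp: rwalk_Cons arcs_ends_def arc_to_ends_def)
    have "awalk u (e # es) (last p)" "awalk_verts u (e # es) = u # p"
      using es e Cons.prems by (auto simp: awalk_Cons_iff)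
    with False show ?thesis by (intro exI[of _ "e # es"]) auto
  qed
qed simp

lemma rwalk_verts:
  assumes "rwalk (arcs_ends G) (u # p)" "p \<noteq> []"
  shows "set (u # p) \<subseteq> verts G"
  using assms
proof (induction p arbitrary: u)
  case (Cons v p)
  then have "(u, v) \<in> arcs_ends G" by (simp add: rwalk_Cons)
  then have "u \<in> verts G" "v \<in> verts G" by (auto simp: arcs_ends_def arc_to_ends_def)
  then show ?case using Cons by (cases "p = []") (auto simp: rwalk_Cons)
qed simp

lemma has_wheatstone_imp_contains:
  assumes "has_wheatstone (arcs_ends G)"
  shows "contains_wheatstone G"
proof -
  let ?R = "rwalk (arcs_ends G)"
  obtain a b c d p1 p2 q1 q2 m where w: "?R (a # p1 @ [b])" "?R (a # q1 @ [c])" "?R (b # m @ [c])"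
    "?R (b # p2 @ [d])" "?R (c # q2 @ [d])"
    and dist: "distinct ([a, b, c, d] @ p1 @ q1 @ m @ p2 @ q2)"
    using assms unfolding has_wheatstone_def by (blast elim: wheatstone_walks_trim)
  define \<phi> where "\<phi> = (\<lambda>n. case n of WA \<Rightarrow> a | WB \<Rightarrow> b | WC \<Rightarrow> c | WD \<Rightarrow> d)"
  define xs where "xs = (\<lambda>e. if e = (WA, WB) then p1 else if e = (WA, WC) then q1
    else if e = (WB, WC) then m else if e = (WB, WD) then p2 else q2)"
  define vs where "vs = (\<lambda>e. \<phi> (fst e) # xs e @ [\<phi> (snd e)])"
  let ?A = "{(WA, WB), (WA, WC), (WB, WC), (WB, WD), (WC, WD)}"
  have \<phi>: "inj_on \<phi> UNIV"
    using dist by (auto simp: inj_on_def \<phi>_def split: wnode.splits)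
  have walks: "\<forall>e \<in> ?A. ?R (vs e)"
    using w by (simp add: vs_def xs_def \<phi>_def)
  then have verts: "\<forall>e \<in> ?A. set (vs e) \<subseteq> verts G"
    unfolding vs_def using rwalk_verts by blast
  have "\<forall>e \<in> ?A. \<exists>es. awalk (hd (vs e)) es (last (vs e)) \<and> awalk_verts (hd (vs e)) es = vs e"
    using rwalk_obtain_awalk walks verts by blast
  then obtain \<psi> where \<psi>: "\<forall>e \<in> ?A. awalk (hd (vs e)) (\<psi> e) (last (vs e)) \<and>
      awalk_verts (hd (vs e)) (\<psi> e) = vs e"
    by metis
  have hl: "hd (vs e) = \<phi> (fst e)" "last (vs e) = \<phi> (snd e)" for e by (auto simp: vs_def)
  \<comment> \<open>A nonempty arc list determines its list of nodes, hence both ends, and distinct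
    edges of the Wheatstone graph differ in an end.\<close>
  have inj: "inj_on \<psi> ?A"
  proof (rule inj_onI)
    fix e f assume ef: "e \<in> ?A" "f \<in> ?A" "\<psi> e = \<psi> f"
    have "vs e = vs f"
    proof -
      have "\<psi> e \<noteq> []"
      proof
        assume "\<psi> e = []"
        then have "length (vs e) = 1" using \<psi> ef(1) length_awalk_verts by (metis One_nat_def list.size(3))
        then show False by (simp add: vs_def)
      qed
      then show ?thesis using \<psi> ef awalk_verts_ne_eq by metis
    qed
    then have "\<phi> (fst e) = \<phi> (fst f)" "\<phi> (snd e) = \<phi> (snd f)" using hl by metis+
    then show "e = f" using \<phi> by (auto simp: inj_on_def prod_eq_iff)
  qed
  have "\<forall>e \<in> ?A. distinct (vs e)"
    using dist by (simp add: vs_def xs_def \<phi>_def)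
  then have paths: "\<forall>e \<in> ?A. apath (\<phi> (fst e)) (\<psi> e) (\<phi> (snd e))"
    using \<psi> unfolding apath_def hl by metis
  have vsA: "\<forall>e \<in> ?A. awalk_verts (\<phi> (fst e)) (\<psi> e) = vs e" using \<psi> unfolding hl by blast
  have dis: "\<forall>e \<in> ?A. \<forall>f \<in> ?A. e \<noteq> f \<longrightarrow> set (vs e) \<inter> set (vs f) \<subseteq> \<phi> ` ({fst e, snd e} \<inter> {fst f, snd f})"
    using dist by (simp add: vs_def xs_def \<phi>_def) blast
  have UN: "{WA, WB, WC, WD} = UNIV" by (auto intro: wnode.exhaust)
  have "\<phi> ` UNIV \<subseteq> verts G"
    using verts unfolding UN[symmetric] vs_def by auto
  with \<phi> inj paths dis vsA show ?thesis
    unfolding contains_wheatstone_def wheatstone_def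
    by (intro exI[of _ \<phi>] exI[of _ \<psi>]) (simp add: UN del: insert_iff ball_simps)
qed

lemma contains_imp_has_wheatstone:
  assumes "contains_wheatstone G"
  shows "has_wheatstone (arcs_ends G)"
proof -
  let ?R = "rwalk (arcs_ends G)"
  let ?A = "{(WA, WB), (WA, WC), (WB, WC), (WB, WD), (WC, WD)}"
  have UN: "{WA, WB, WC, WD} = UNIV" by (auto intro: wnode.exhaust)
  obtain \<phi> :: "wnode \<Rightarrow> 'a" and \<psi> where \<phi>: "inj \<phi>"
    and paths: "\<forall>e \<in> ?A. apath (\<phi> (fst e)) (\<psi> e) (\<phi> (snd e))"
    and dis: "\<forall>e \<in> ?A. \<forall>f \<in> ?A. e \<noteq> f \<longrightarrow> set (awalk_verts (\<phi> (fst e)) (\<psi> e)) \<inter>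
       set (awalk_verts (\<phi> (fst f)) (\<psi> f)) \<subseteq> \<phi> ` ({fst e, snd e} \<inter> {fst f, snd f})"
    using assms unfolding contains_wheatstone_def wheatstone_def pre_digraph.simps UN by metis
  have "\<exists>m. awalk_verts (\<phi> (fst e)) (\<psi> e) = \<phi> (fst e) # m @ [\<phi> (snd e)] \<and>
      ?R (\<phi> (fst e) # m @ [\<phi> (snd e)]) \<and> distinct (\<phi> (fst e) # m @ [\<phi> (snd e)])"
    if e: "e \<in> ?A" for e
  proof -
    let ?u = "\<phi> (fst e)" and ?v = "\<phi> (snd e)"
    have p: "awalk ?u (\<psi> e) ?v" "distinct (awalk_verts ?u (\<psi> e))"
      using paths e by (auto simp: apath_def)
    have "?u \<noteq> ?v" using \<phi> e by (auto simp: inj_eq)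
    have hl: "hd (awalk_verts ?u (\<psi> e)) = ?u" "last (awalk_verts ?u (\<psi> e)) = ?v" using p by auto
    obtain m' where m': "awalk_verts ?u (\<psi> e) = ?u # m'"
      using hl(1) by (metis awalk_verts_non_Nil list.collapse)
    then have "m' \<noteq> []" "last m' = ?v" using hl(2) \<open>?u \<noteq> ?v\<close> by (auto split: if_splits)
    then obtain m where "m' = m @ [?v]" by (metis append_butlast_last_id)
    then show ?thesis using m' p rwalk_awalk_verts[OF p(1)] by auto
  qed
  then obtain m where m: "\<And>e. e \<in> ?A \<Longrightarrow> awalk_verts (\<phi> (fst e)) (\<psi> e) = \<phi> (fst e) # m e @ [\<phi> (snd e)] \<and>
      ?R (\<phi> (fst e) # m e @ [\<phi> (snd e)]) \<and> distinct (\<phi> (fst e) # m e @ [\<phi> (snd e)])"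
    by metis
  have common: "z \<in> \<phi> ` ({fst e, snd e} \<inter> {fst f, snd f})"
    if "e \<in> ?A" "f \<in> ?A" "e \<noteq> f" "z \<in> set (\<phi> (fst e) # m e @ [\<phi> (snd e)])"
      "z \<in> set (\<phi> (fst f) # m f @ [\<phi> (snd f)])" for e f z
  proof -
    have "set (awalk_verts (\<phi> (fst e)) (\<psi> e)) \<inter> set (awalk_verts (\<phi> (fst f)) (\<psi> f))
        \<subseteq> \<phi> ` ({fst e, snd e} \<inter> {fst f, snd f})"
      using dis that(1-3) by blast
    then show ?thesis using m[OF that(1)] m[OF that(2)] that(4,5) by auto
  qed
  \<comment> \<open>Every node of the Wheatstone graph lies on at least two edges, so some edge f
    other than e has n as an end. Disjointness of the two paths makes n an end of e too, and then
    the path of e would visit its image twice.\<close>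
  have node: "\<phi> n \<notin> set (m e)" if e: "e \<in> ?A" for n e
  proof
    assume n: "\<phi> n \<in> set (m e)"
    obtain f where f: "f \<in> ?A" "f \<noteq> e" "n = fst f \<or> n = snd f"
    proof -
      have "\<exists>f \<in> ?A. f \<noteq> e \<and> (n = fst f \<or> n = snd f)"
        using e by (cases n) auto
      then show ?thesis using that by blast
    qed
    have "\<phi> n \<in> \<phi> ` ({fst e, snd e} \<inter> {fst f, snd f})"
      by (rule common[OF e f(1)]) (use f n in auto)
    then have "n = fst e \<or> n = snd e" using \<phi> by (auto simp: inj_eq)
    then show False using m[OF e] n by auto
  qed
  have dism: "set (m e) \<inter> set (m f) = {}" if ef: "e \<in> ?A" "f \<in> ?A" "e \<noteq> f" for e f
  proof (rule ccontr)
    assume "\<not> ?thesis"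
    then obtain z where z: "z \<in> set (m e)" "z \<in> set (m f)" by blast
    have "z \<in> \<phi> ` ({fst e, snd e} \<inter> {fst f, snd f})"
      by (rule common[OF ef]) (use z in auto)
    then show False using node[OF ef(1)] z by auto
  qed
  let ?p = "m (WA, WB) @ \<phi> WB # m (WB, WD)" and ?q = "m (WA, WC) @ \<phi> WC # m (WC, WD)"
  let ?r = "\<phi> WB # m (WB, WC) @ [\<phi> WC]"
  have d: "distinct (m (WA, WB))" "distinct (m (WA, WC))" "distinct (m (WB, WD))" "distinct (m (WC, WD))"
    and w: "?R (\<phi> WA # m (WA, WB) @ [\<phi> WB])" "?R (\<phi> WB # m (WB, WD) @ [\<phi> WD])"
      "?R (\<phi> WA # m (WA, WC) @ [\<phi> WC])" "?R (\<phi> WC # m (WC, WD) @ [\<phi> WD])" "?R ?r"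
    using m by fastforce+
  have nd: "\<phi> n \<notin> set (m (WA, WB))" "\<phi> n \<notin> set (m (WA, WC))" "\<phi> n \<notin> set (m (WB, WC))"
    "\<phi> n \<notin> set (m (WB, WD))" "\<phi> n \<notin> set (m (WC, WD))" for n
    by (intro node; simp)+
  have disj: "set (m (WA, WB)) \<inter> set (m (WB, WD)) = {}" "set (m (WA, WC)) \<inter> set (m (WC, WD)) = {}"
    "set (m (WA, WB)) \<inter> set (m (WA, WC)) = {}" "set (m (WA, WB)) \<inter> set (m (WC, WD)) = {}"
    "set (m (WB, WD)) \<inter> set (m (WA, WC)) = {}" "set (m (WB, WD)) \<inter> set (m (WC, WD)) = {}"
    by (intro dism; simp)+
  have "?R (\<phi> WA # ?p @ [\<phi> WD])" "?R (\<phi> WA # ?q @ [\<phi> WD])"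
    using rwalk_join(1)[OF w(1,2)] rwalk_join(1)[OF w(3,4)] by simp_all
  moreover have "distinct ?p" "distinct ?q" "set ?p \<inter> set ?q = {}"
    using d nd disj \<phi> by (simp_all add: inj_eq Int_Un_distrib Int_Un_distrib2)
  moreover have "{\<phi> WA, \<phi> WD} \<inter> (set ?p \<union> set ?q \<union> set ?r) = {}"
    using nd \<phi> by (simp add: inj_eq)
  moreover have "\<phi> WA \<noteq> \<phi> WD" using \<phi> by (simp add: inj_eq)
  ultimately have "wheatstone_walks (arcs_ends G) (\<phi> WA) (\<phi> WD) ?p ?q ?r"
    unfolding wheatstone_walks_def using w(5) by simp
  then show ?thesis unfolding has_wheatstone_def by blast
qed

end

section \<open>Invariance under renumbering of the nodes and under loops\<close>

lemma rwalk_map_image: "rwalk E p \<Longrightarrow> rwalk (map_prod f f ` E) (map f p)"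
  by (auto simp: rwalk_def successively_map elim!: successively_mono)

lemma rwalk_Field: "rwalk E p \<Longrightarrow> hd p \<in> Field E \<Longrightarrow> set p \<subseteq> Field E"
proof (induction p)
  case (Cons u p)
  then show ?case by (cases "p = []") (auto simp: rwalk_Cons FieldI2)
qed simp

text \<open>A numbering of the nodes is injective only on the nodes of the graph; this is enough,
  since all nodes of the configuration lie in the field of the relation.\<close>

lemma has_wheatstone_image:
  assumes "has_wheatstone E" "inj_on f (Field E)"
  shows "has_wheatstone (map_prod f f ` E)"
proof -
  obtain a d p q r where w: "wheatstone_walks E a d p q r"
    using assms(1) by (auto simp: has_wheatstone_def)
  have ne: "p \<noteq> []" "q \<noteq> []" "r \<noteq> []" using w by (auto simp: wheatstone_walks_def)
  have "a \<in> Field E"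
    using w ne by (auto simp: wheatstone_walks_def rwalk_between FieldI1)
  then have ad: "set (a # p @ [d]) \<subseteq> Field E" "set (a # q @ [d]) \<subseteq> Field E"
    using w unfolding wheatstone_walks_def by (metis list.sel(1) rwalk_Field)+
  then have "hd r \<in> Field E" using w by (auto simp: wheatstone_walks_def)
  then have "set r \<subseteq> Field E" using w rwalk_Field by (auto simp: wheatstone_walks_def)
  with ad have F: "{a, d} \<union> set p \<union> set q \<union> set r \<subseteq> Field E" by auto
  have f: "f u = f v \<longleftrightarrow> u = v" if "u \<in> {a, d} \<union> set p \<union> set q \<union> set r"
      "v \<in> {a, d} \<union> set p \<union> set q \<union> set r" for u v
    using that F assms(2) by (meson inj_on_eq_iff subsetD)
  then have inj: "inj_on f ({a, d} \<union> set p \<union> set q \<union> set r)" unfolding inj_on_def by blast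
  have "wheatstone_walks (map_prod f f ` E) (f a) (f d) (map f p) (map f q) (map f r)"
    unfolding wheatstone_walks_def
  proof (intro conjI)
    show "rwalk (map_prod f f ` E) (f a # map f p @ [f d])"
      "rwalk (map_prod f f ` E) (f a # map f q @ [f d])" "rwalk (map_prod f f ` E) (map f r)"
      using w rwalk_map_image[of E "a # p @ [d]" f] rwalk_map_image[of E "a # q @ [d]" f]
        rwalk_map_image[of E r f] by (simp_all add: wheatstone_walks_def)
    show "f a \<noteq> f d" using w f by (auto simp: wheatstone_walks_def)
    show "distinct (map f p)" "distinct (map f q)"
      using w f by (auto simp: wheatstone_walks_def distinct_map inj_on_def)
    have sub: "set p \<subseteq> {a, d} \<union> set p \<union> set q \<union> set r" "set q \<subseteq> {a, d} \<union> set p \<union> set q \<union> set r"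
      "{a, d} \<subseteq> {a, d} \<union> set p \<union> set q \<union> set r"
      "set p \<union> set q \<union> set r \<subseteq> {a, d} \<union> set p \<union> set q \<union> set r"
      by blast+
    have "set p \<inter> set q = {}" "{a, d} \<inter> (set p \<union> set q \<union> set r) = {}"
      using w by (simp_all add: wheatstone_walks_def)
    then show "set (map f p) \<inter> set (map f q) = {}"
      "{f a, f d} \<inter> (set (map f p) \<union> set (map f q) \<union> set (map f r)) = {}"
      using inj_on_image_Int[OF inj sub(1,2)] inj_on_image_Int[OF inj sub(3,4)]
      by (simp_all add: image_Un)
    show "hd (map f r) \<in> set (map f p)" "last (map f r) \<in> set (map f q)"
      using w ne by (auto simp: wheatstone_walks_def hd_map last_map)
  qed
  then show ?thesis unfolding has_wheatstone_def by blast
qed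

lemma Field_map_prod_image: "Field (map_prod f f ` E) = f ` Field E"
  by (force simp: Field_def)

lemma has_wheatstone_image_iff:
  assumes "inj_on f (Field E)"
  shows "has_wheatstone (map_prod f f ` E) \<longleftrightarrow> has_wheatstone E"
proof
  assume *: "has_wheatstone (map_prod f f ` E)"
  have "inj_on (inv_into (Field E) f) (Field (map_prod f f ` E))"
    by (simp add: Field_map_prod_image inj_on_inv_into)
  from has_wheatstone_image[OF * this]
  have "has_wheatstone (map_prod (inv_into (Field E) f) (inv_into (Field E) f) ` map_prod f f ` E)" .
  moreover have "map_prod (inv_into (Field E) f) (inv_into (Field E) f) (map_prod f f e) = e"
    if "e \<in> E" for e
    using that assms by (cases e) (auto simp: FieldI1 FieldI2)
  ultimately show "has_wheatstone E" by (simp add: image_image)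
qed (rule has_wheatstone_image[OF _ assms])

lemma has_wheatstone_mono: "has_wheatstone E \<Longrightarrow> E \<subseteq> E' \<Longrightarrow> has_wheatstone E'"
  unfolding has_wheatstone_def wheatstone_walks_def
  by (elim exE conjE, intro exI conjI) (assumption | erule (1) rwalk_mono)+

lemma rwalk_insert_loop: "rwalk (insert (z, z) E) p \<Longrightarrow> distinct p \<Longrightarrow> rwalk E p"
proof (induction p)
  case (Cons u p)
  then show ?case by (cases "p = []") (auto simp: rwalk_Cons)
qed simp

text \<open>Simple walks use no loop, and the bridge can be made simple. This disposes of the arc
  (0, 0) that arises when the input is read past its end.\<close>

lemma has_wheatstone_insert_loop: "has_wheatstone (insert (z, z) E) \<longleftrightarrow> has_wheatstone E"
proof
  assume "has_wheatstone (insert (z, z) E)"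
  then obtain a d p q r where w: "wheatstone_walks (insert (z, z) E) a d p q r"
    by (auto simp: has_wheatstone_def)
  then obtain r' where r': "rwalk (insert (z, z) E) r'" "distinct r'" "hd r' = hd r" "last r' = last r"
      "set r' \<subseteq> set r"
    using rwalk_distinct[of "insert (z, z) E" r] by (auto simp: wheatstone_walks_def)
  have "distinct (a # p @ [d])" "distinct (a # q @ [d])"
    using w by (auto simp: wheatstone_walks_def)
  then have "rwalk E (a # p @ [d])" "rwalk E (a # q @ [d])" "rwalk E r'"
    using w r' rwalk_insert_loop[of z E] unfolding wheatstone_walks_def by blast+
  with w r' have "wheatstone_walks E a d p q r'"
    by (auto simp: wheatstone_walks_def)
  then show "has_wheatstone E" unfolding has_wheatstone_def by blast
qed (auto elim: has_wheatstone_mono)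

section \<open>Structured programs for the random access machine\<close>

text \<open>Control flow tests for nonzero only, as \<open>JumpZero\<close> is the only conditional
  jump. Blocks are meant to be free of jumps, which \<open>exec\<close> enforces.\<close>

datatype cmd = Block "instr list" | Seq cmd cmd | If_nonzero nat cmd | While_nonzero nat cmd

fun is_jump :: "instr \<Rightarrow> bool" where
  "is_jump (Jump l) = True"
| "is_jump (JumpZero i l) = True"
| "is_jump _ = False"

text \<open>The program counter does not influence the registers, hence the fixed 0.\<close>

definition run_block :: "nat list \<Rightarrow> instr list \<Rightarrow> (nat \<Rightarrow> nat) \<Rightarrow> (nat \<Rightarrow> nat)" where
  "run_block w xs R = foldl (\<lambda>R x. snd (exec_instr w x (0, R))) R xs"

lemma run_block_simps [simp]:
  "run_block w [] R = R"
  "run_block w (x # xs) R = run_block w xs (snd (exec_instr w x (0, R)))"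
  by (simp_all add: run_block_def)

lemma run_block_append: "run_block w (xs @ ys) R = run_block w ys (run_block w xs R)"
  by (simp add: run_block_def)

fun code_len :: "cmd \<Rightarrow> nat" where
  "code_len (Block xs) = length xs"
| "code_len (Seq c c') = code_len c + code_len c'"
| "code_len (If_nonzero r c) = Suc (code_len c)"
| "code_len (While_nonzero r c) = code_len c + 2"

fun compile :: "nat \<Rightarrow> cmd \<Rightarrow> program" where
  "compile l (Block xs) = xs"
| "compile l (Seq c c') = compile l c @ compile (l + code_len c) c'"
| "compile l (If_nonzero r c) = JumpZero r (Suc (l + code_len c)) # compile (Suc l) c"
| "compile l (While_nonzero r c) = JumpZero r (l + code_len c + 2) # compile (Suc l) c @ [Jump l]"

lemma length_compile [simp]: "length (compile l c) = code_len c"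
  by (induction c arbitrary: l) auto

text \<open>The number is the exact count of machine steps after compilation: an
  \<open>If_nonzero\<close> pays one for its test, and a round of \<open>While_nonzero\<close> pays
  two, for the test and the jump back.\<close>

inductive exec :: "nat list \<Rightarrow> cmd \<Rightarrow> (nat \<Rightarrow> nat) \<Rightarrow> nat \<Rightarrow> (nat \<Rightarrow> nat) \<Rightarrow> bool" for w where
  exec_Block: "\<forall>x \<in> set xs. \<not> is_jump x \<Longrightarrow> exec w (Block xs) R (length xs) (run_block w xs R)"
| exec_Seq: "exec w c R n R' \<Longrightarrow> exec w c' R' n' R'' \<Longrightarrow> exec w (Seq c c') R (n + n') R''"
| exec_If_zero: "R r = 0 \<Longrightarrow> exec w (If_nonzero r c) R 1 R"
| exec_If: "R r \<noteq> 0 \<Longrightarrow> exec w c R n R' \<Longrightarrow> exec w (If_nonzero r c) R (Suc n) R'"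
| exec_While_zero: "R r = 0 \<Longrightarrow> exec w (While_nonzero r c) R 1 R"
| exec_While: "R r \<noteq> 0 \<Longrightarrow> exec w c R n R' \<Longrightarrow> exec w (While_nonzero r c) R' n' R'' \<Longrightarrow>
    exec w (While_nonzero r c) R (n + n' + 2) R''"

definition code_at :: "program \<Rightarrow> nat \<Rightarrow> program \<Rightarrow> bool" where
  "code_at P l xs \<longleftrightarrow> (\<exists>pre post. P = pre @ xs @ post \<and> length pre = l)"

lemma code_at_append:
  assumes "code_at P l (xs @ ys)"
  shows "code_at P l xs" "code_at P (l + length xs) ys"
proof -
  obtain pre post where P: "P = pre @ xs @ ys @ post" "length pre = l"
    using assms by (auto simp: code_at_def)
  show "code_at P l xs" using P by (auto simp: code_at_def)
  have "P = (pre @ xs) @ ys @ post \<and> length (pre @ xs) = l + length xs" using P by simp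
  then show "code_at P (l + length xs) ys" unfolding code_at_def by blast
qed

lemma code_at_Cons:
  assumes "code_at P l (x # xs)"
  shows "step P w (l, R) = exec_instr w x (l, R)" "code_at P (Suc l) xs"
proof -
  obtain pre post where P: "P = pre @ x # xs @ post" "length pre = l"
    using assms by (auto simp: code_at_def)
  then have "l < length P" "P ! l = x" by (auto simp: nth_append)
  then show "step P w (l, R) = exec_instr w x (l, R)" by (simp add: step_def halted_def)
  show "code_at P (Suc l) xs"
    using code_at_append(2)[of P l "[x]" xs] assms by simp
qed

lemma exec_instr_no_jump:
  "\<not> is_jump x \<Longrightarrow> exec_instr w x (l, R) = (Suc l, snd (exec_instr w x (0, R)))"
  by (cases x) auto

lemma step_block:
  "code_at P l xs \<Longrightarrow> \<forall>x \<in> set xs. \<not> is_jump x \<Longrightarrow>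
   (step P w ^^ length xs) (l, R) = (l + length xs, run_block w xs R)"
proof (induction xs arbitrary: l R)
  case (Cons x xs)
  have "step P w (l, R) = (Suc l, snd (exec_instr w x (0, R)))"
    using code_at_Cons(1)[OF Cons.prems(1), of w R] Cons.prems(2) exec_instr_no_jump[of x w l R] by simp
  then show ?case
    using Cons.IH[OF code_at_Cons(2)[OF Cons.prems(1)]] Cons.prems(2)
    by (simp add: funpow_Suc_right del: funpow.simps)
qed simp

theorem compile_correct:
  "exec w c R n R' \<Longrightarrow> code_at P l (compile l c) \<Longrightarrow>
   (step P w ^^ n) (l, R) = (l + code_len c, R')"
proof (induction arbitrary: l rule: exec.induct)
  case (exec_Block xs R)
  then show ?case using step_block by simp
next
  case (exec_Seq c R n R' c' n' R'')
  then have "code_at P l (compile l c)" "code_at P (l + code_len c) (compile (l + code_len c) c')"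
    using code_at_append[of P l "compile l c"] by auto
  with exec_Seq.IH show ?case
    by (subst add.commute[of n n']) (simp add: funpow_add add.assoc)
next
  case (exec_If_zero R r c)
  then show ?case using code_at_Cons(1)[of P l "JumpZero r (Suc (l + code_len c))"] by simp
next
  case (exec_If R r c n R')
  then have "step P w (l, R) = (Suc l, R)" "code_at P (Suc l) (compile (Suc l) c)"
    using code_at_Cons[of P l "JumpZero r (Suc (l + code_len c))"] by auto
  with exec_If.IH show ?case by (simp add: funpow_Suc_right del: funpow.simps)
next
  case (exec_While_zero R r c)
  then show ?case using code_at_Cons(1)[of P l "JumpZero r (l + code_len c + 2)"] by simp
next
  case (exec_While R r c n R' n' R'')
  have 1: "step P w (l, R) = (Suc l, R)" "code_at P (Suc l) (compile (Suc l) c @ [Jump l])"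
    using code_at_Cons[of P l "JumpZero r (l + code_len c + 2)"] exec_While by auto
  then have 2: "code_at P (Suc l) (compile (Suc l) c)" "code_at P (Suc l + code_len c) [Jump l]"
    using code_at_append[of P "Suc l" "compile (Suc l) c"] by auto
  then have 3: "step P w (Suc l + code_len c, R') = (l, R')"
    using code_at_Cons(1)[of P "Suc l + code_len c" "Jump l"] by simp
  \<comment> \<open>Powers of \<open>step\<close> compose from right to left, so the summands appear
    in reverse order of execution.\<close>
  have "n + n' + 2 = n' + (1 + (n + 1))" by simp
  then have "(step P w ^^ (n + n' + 2)) (l, R) =
      (step P w ^^ n') ((step P w ^^ 1) ((step P w ^^ n) ((step P w ^^ 1) (l, R))))"
    by (simp only: funpow_add o_apply)
  also have "\<dots> = (step P w ^^ n') (l, R')"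
    using exec_While.IH(1)[OF 2(1)] 1(1) 3 by simp
  also have "\<dots> = (l + code_len (While_nonzero r c), R'')"
    using exec_While.IH(2)[OF exec_While.prems] .
  finally show ?case .
qed

text \<open>Total correctness with a time budget: an execution has to exist, so termination is part
  of the claim.\<close>

definition wp :: "nat list \<Rightarrow> cmd \<Rightarrow> nat \<Rightarrow> ((nat \<Rightarrow> nat) \<Rightarrow> bool) \<Rightarrow> (nat \<Rightarrow> nat) \<Rightarrow> bool" where
  "wp w c T \<Phi> R \<longleftrightarrow> (\<exists>n R'. exec w c R n R' \<and> n \<le> T \<and> \<Phi> R')"

lemma wp_mono: "wp w c T \<Phi> R \<Longrightarrow> T \<le> T' \<Longrightarrow> (\<And>R'. \<Phi> R' \<Longrightarrow> \<Psi> R') \<Longrightarrow> wp w c T' \<Psi> R"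
  unfolding wp_def by (meson le_trans)

lemma wp_Block:
  "\<forall>x \<in> set xs. \<not> is_jump x \<Longrightarrow> \<Phi> (run_block w xs R) \<Longrightarrow> length xs \<le> T \<Longrightarrow> wp w (Block xs) T \<Phi> R"
  unfolding wp_def using exec_Block by blast

lemma wp_Seq:
  assumes "wp w c T \<Psi> R" "\<And>R'. \<Psi> R' \<Longrightarrow> wp w c' T' \<Phi> R'"
  shows "wp w (Seq c c') (T + T') \<Phi> R"
proof -
  obtain n R' where 1: "exec w c R n R'" "n \<le> T" "\<Psi> R'" using assms(1) by (auto simp: wp_def)
  obtain n' R'' where 2: "exec w c' R' n' R''" "n' \<le> T'" "\<Phi> R''"
    using assms(2)[OF 1(3)] by (auto simp: wp_def)
  show ?thesis unfolding wp_def using exec_Seq[OF 1(1) 2(1)] 1 2 by (meson add_mono)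
qed

lemma wp_If:
  assumes "R r \<noteq> 0 \<Longrightarrow> wp w c T \<Phi> R" "R r = 0 \<Longrightarrow> \<Phi> R"
  shows "wp w (If_nonzero r c) (Suc T) \<Phi> R"
proof (cases "R r = 0")
  case True
  then show ?thesis unfolding wp_def using assms exec_If_zero[of R r w c]
    by (intro exI[of _ 1] exI[of _ R]) auto
next
  case False
  then obtain n R' where "exec w c R n R'" "n \<le> T" "\<Phi> R'" using assms by (auto simp: wp_def)
  with False show ?thesis unfolding wp_def
    by (intro exI[of _ "Suc n"] exI[of _ R']) (auto intro: exec_If)
qed

text \<open>
  Throughout, register 14 contains the common bound of all loops, register 2 the constant 1 and
  register 15 the constant 0; registers 12 and 13 are scratch.
\<close>
definition For :: "nat \<Rightarrow> cmd \<Rightarrow> cmd" where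
  "For i c = Seq (Block [Const i 0, Sub 13 14 i])
     (While_nonzero 13 (Seq c (Block [Add i i 2, Sub 13 14 i])))"

text \<open>The body must restore the invariant for the state after the loop control has changed i
  and 13. Each round adds four steps to the body: two updates, the test and the jump back. The 3
  stands for two initial instructions and the final test.\<close>

lemma wp_For:
  assumes i: "i \<notin> {2, 13, 14}" and R: "R 14 = N" "R 2 = 1"
    and init: "I 0 (R(i := 0, 13 := N))"
    and body: "\<And>j R. j < N \<Longrightarrow> I j R \<Longrightarrow> R i = j \<Longrightarrow> R 14 = N \<Longrightarrow> R 2 = 1 \<Longrightarrow>
      wp w c T (\<lambda>R'. R' i = j \<and> R' 14 = N \<and> R' 2 = 1 \<and> I (Suc j) (R'(i := Suc j, 13 := N - Suc j))) R"
    and post: "\<And>R. I N R \<Longrightarrow> \<Phi> R"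
  shows "wp w (For i c) (3 + N * (T + 4)) \<Phi> R"
proof -
  let ?c = "Seq c (Block [Add i i 2, Sub 13 14 i])"
  have loop: "wp w (While_nonzero 13 ?c) (Suc (k * (T + 4))) \<Phi> R"
    if "I j R" "R i = j" "R 13 = N - j" "R 14 = N" "R 2 = 1" "j + k = N" for j k R
    using that
  proof (induction k arbitrary: j R)
    case 0
    then have "exec w (While_nonzero 13 ?c) R 1 R" by (intro exec_While_zero) simp
    with 0 post show ?case unfolding wp_def
      by (intro exI[of _ 1] exI[of _ R]) simp
  next
    case (Suc k)
    have "wp w ?c (T + 2) (\<lambda>R'. I (Suc j) R' \<and> R' i = Suc j \<and> R' 13 = N - Suc j \<and> R' 14 = N \<and> R' 2 = 1) R"
    proof (rule wp_Seq[OF body])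
      fix R' :: "nat \<Rightarrow> nat"
      assume R': "R' i = j \<and> R' 14 = N \<and> R' 2 = 1 \<and> I (Suc j) (R'(i := Suc j, 13 := N - Suc j))"
      then have "run_block w [Add i i 2, Sub 13 14 i] R' = R'(i := Suc j, 13 := N - Suc j)"
        using i by simp
      then show "wp w (Block [Add i i 2, Sub 13 14 i]) 2 (\<lambda>R'. I (Suc j) R' \<and> R' i = Suc j \<and>
          R' 13 = N - Suc j \<and> R' 14 = N \<and> R' 2 = 1) R'"
        using R' i by (intro wp_Block) (simp_all del: run_block_simps)
    qed (use Suc in simp_all)
    then obtain n R' where 1: "exec w ?c R n R'" "n \<le> T + 2"
      "I (Suc j) R'" "R' i = Suc j" "R' 13 = N - Suc j" "R' 14 = N" "R' 2 = 1"
      by (auto simp: wp_def)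
    then obtain n' R'' where 2: "exec w (While_nonzero 13 ?c) R' n' R''" "n' \<le> Suc (k * (T + 4))" "\<Phi> R''"
      using Suc.IH[of "Suc j" R'] Suc.prems(6) unfolding wp_def by auto
    have "R 13 \<noteq> 0" using Suc.prems by auto
    from exec_While[where r = 13, OF this 1(1) 2(1)] 1(2) 2 show ?case
      unfolding wp_def by (intro exI[of _ "n + n' + 2"] exI[of _ R'']) auto
  qed
  let ?R = "R(i := 0, 13 := N)"
  have "run_block w [Const i 0, Sub 13 14 i] R = ?R" using i R by simp
  then have "wp w (Block [Const i 0, Sub 13 14 i]) 2 (\<lambda>R'. R' = ?R) R"
    by (intro wp_Block) (simp_all del: run_block_simps)
  moreover have "wp w (While_nonzero 13 ?c) (Suc (N * (T + 4))) \<Phi> ?R"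
    by (rule loop[OF init]) (use i R in simp_all)
  ultimately have "wp w (For i c) (2 + Suc (N * (T + 4))) \<Phi> R"
    unfolding For_def by (blast intro: wp_Seq)
  then show ?thesis by (simp add: eval_nat_numeral)
qed

section \<open>Horn rules over arcs\<close>

datatype test = Marked nat nat | Same nat nat | Diff nat nat

text \<open>
  Rules refer to node variables by the register that holds them: 3, 4, 5, 6 for \<open>a\<close>, \<open>d\<close>, \<open>k\<close>, \<open>x\<close>,
  and 9, 10 for the tail and the head of the current arc. A mark \<open>(t, v)\<close> is derived knowledge about
  the node \<open>v\<close>, where \<open>t\<close> is one of four tags.
\<close>
type_synonym rule = "test list \<times> nat \<times> nat"

fun holds :: "(nat \<Rightarrow> nat) \<Rightarrow> (nat \<times> nat) set \<Rightarrow> test \<Rightarrow> bool" where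
  "holds V S (Marked t r) \<longleftrightarrow> (t, V r) \<in> S"
| "holds V S (Same i j) \<longleftrightarrow> V i = V j"
| "holds V S (Diff i j) \<longleftrightarrow> V i \<noteq> V j"

fun apply_rule :: "(nat \<Rightarrow> nat) \<Rightarrow> (nat \<times> nat) set \<Rightarrow> rule \<Rightarrow> (nat \<times> nat) set" where
  "apply_rule V S (ts, t, r) = (if \<forall>\<tau> \<in> set ts. holds V S \<tau> then insert (t, V r) S else S)"

definition var_regs :: "nat set" where
  "var_regs = {3, 4, 5, 6, 9, 10}"

fun wf_test :: "test \<Rightarrow> bool" where
  "wf_test (Marked t r) \<longleftrightarrow> t < 4 \<and> r \<in> var_regs"
| "wf_test (Same i j) \<longleftrightarrow> i \<in> var_regs \<and> j \<in> var_regs"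
| "wf_test (Diff i j) \<longleftrightarrow> i \<in> var_regs \<and> j \<in> var_regs"

fun wf_rule :: "rule \<Rightarrow> bool" where
  "wf_rule (ts, t, r) \<longleftrightarrow> (\<forall>\<tau> \<in> set ts. wf_test \<tau>) \<and> t < 4 \<and> r \<in> var_regs"

lemma holds_cong: "wf_test \<tau> \<Longrightarrow> \<forall>i \<in> var_regs. V i = V' i \<Longrightarrow> holds V S \<tau> = holds V' S \<tau>"
  by (cases \<tau>) auto

lemma apply_rule_cong:
  "wf_rule \<rho> \<Longrightarrow> \<forall>i \<in> var_regs. V i = V' i \<Longrightarrow> apply_rule V S \<rho> = apply_rule V' S \<rho>"
proof (cases \<rho>)
  case (fields ts t r)
  assume "wf_rule \<rho>" "\<forall>i \<in> var_regs. V i = V' i"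
  then have "(\<forall>\<tau> \<in> set ts. holds V S \<tau>) = (\<forall>\<tau> \<in> set ts. holds V' S \<tau>)" "V r = V' r"
    using holds_cong[of _ V V' S] by (auto simp: fields)
  then show ?thesis by (simp add: fields)
qed

text \<open>Registers below 16 hold scalars.\<close>
definition marks :: "(nat \<Rightarrow> nat) \<Rightarrow> (nat \<times> nat) set" where
  "marks R = {(t, v). t < 4 \<and> R (16 + 4 * v + t) \<noteq> 0}"

text \<open>A frame condition for scalar registers: only those in W may change. The cells from 16 on
  are left open because \<open>marks\<close> describes them.\<close>

definition agree :: "nat set \<Rightarrow> (nat \<Rightarrow> nat) \<Rightarrow> (nat \<Rightarrow> nat) \<Rightarrow> bool" where
  "agree W R R' \<longleftrightarrow> (\<forall>i < 16. i \<notin> W \<longrightarrow> R' i = R i)"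

lemma marks_scalar [simp]: "i < 16 \<Longrightarrow> marks (R(i := y)) = marks R"
  by (auto simp: marks_def)

lemma marks_set: "t < 4 \<Longrightarrow> y \<noteq> 0 \<Longrightarrow> marks (R(16 + 4 * v + t := y)) = insert (t, v) (marks R)"
proof -
  assume t: "t < 4" "y \<noteq> 0"
  then have "16 + 4 * v' + t' = 16 + 4 * v + t \<longleftrightarrow> t' = t \<and> v' = v" if "t' < 4" for t' v'
    using that by presburger
  then show ?thesis using t by (auto simp: marks_def)
qed

lemma agree_refl [simp]: "agree W R R"
  by (simp add: agree_def)

lemma agree_trans: "agree W R R' \<Longrightarrow> agree W R' R'' \<Longrightarrow> agree W R R''"
  unfolding agree_def by metis

lemma agree_mono: "agree W R R' \<Longrightarrow> W \<subseteq> W' \<Longrightarrow> agree W' R R'"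
  unfolding agree_def by blast

lemma agree_upd [simp]: "i \<in> W \<or> 16 \<le> i \<Longrightarrow> agree W R (R'(i := y)) = agree W R R'"
  unfolding agree_def by (metis fun_upd_apply not_le)

lemma agreeD: "agree W R R' \<Longrightarrow> i < 16 \<Longrightarrow> i \<notin> W \<Longrightarrow> R' i = R i"
  unfolding agree_def by blast

text \<open>Two doublings replace the missing multiplication by 4.\<close>

definition address :: "nat \<Rightarrow> nat \<Rightarrow> instr list" where
  "address t r = [Add 12 r r, Add 12 12 12, Const 13 (16 + t), Add 12 12 13]"

lemma run_address:
  "run_block w (address t r) R = R(13 := 16 + t, 12 := 16 + 4 * R r + t)"
  by (auto simp: address_def fun_eq_iff)

lemma address_no_jump [simp]: "x \<in> set (address t r) \<Longrightarrow> \<not> is_jump x" "length (address t r) = 4"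
  by (auto simp: address_def)

text \<open>The outcome is left in register 12, nonzero for true. The two truncated differences add
  up to the distance of the values, and 1 minus this distance is nonzero exactly for equal
  values.\<close>

fun code_of_test :: "test \<Rightarrow> instr list" where
  "code_of_test (Marked t r) = address t r @ [Load 12 12]"
| "code_of_test (Diff i j) = [Sub 12 i j, Sub 13 j i, Add 12 12 13]"
| "code_of_test (Same i j) = [Sub 12 i j, Sub 13 j i, Add 12 12 13, Sub 12 2 12]"

lemma var_regs_less: "r \<in> var_regs \<Longrightarrow> r < 12"
  by (auto simp: var_regs_def)

lemma agree_vars: "agree {12, 13} R R' \<Longrightarrow> \<forall>i \<in> var_regs. R' i = R i"
  unfolding agree_def var_regs_def by simp

lemma run_code_of_test:
  assumes "wf_test \<tau>" "R 2 = 1"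
  shows "run_block w (code_of_test \<tau>) R 12 \<noteq> 0 \<longleftrightarrow> holds R (marks R) \<tau>"
    and "agree {12, 13} R (run_block w (code_of_test \<tau>) R)"
    and "marks (run_block w (code_of_test \<tau>) R) = marks R"
proof -
  have regs: "i \<noteq> 12" "i \<noteq> 13" if "i \<in> var_regs" for i
    using that var_regs_less by fastforce+
  show "run_block w (code_of_test \<tau>) R 12 \<noteq> 0 \<longleftrightarrow> holds R (marks R) \<tau>"
    using assms regs by (cases \<tau>) (auto simp: run_block_append run_address marks_def)
  show "agree {12, 13} R (run_block w (code_of_test \<tau>) R)"
    by (cases \<tau>) (simp_all add: run_block_append run_address del: fun_upd_apply)
  show "marks (run_block w (code_of_test \<tau>) R) = marks R"
    by (cases \<tau>) (simp_all add: run_block_append run_address del: fun_upd_apply)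
qed

lemma code_of_test_no_jump: "x \<in> set (code_of_test \<tau>) \<Longrightarrow> \<not> is_jump x" "length (code_of_test \<tau>) \<le> 5"
  by (cases \<tau>; auto)+

fun rule_cmd :: "rule \<Rightarrow> cmd" where
  "rule_cmd ([], t, r) = Block (address t r @ [Store 12 2])"
| "rule_cmd (\<tau> # ts, t, r) = Seq (Block (code_of_test \<tau>)) (If_nonzero 12 (rule_cmd (ts, t, r)))"

text \<open>A test costs at most five instructions and one branch, and setting the mark costs five.
  Tests touch only 12 and 13, so the later tests see the same variables and marks.\<close>

lemma wp_rule_cmd:
  assumes "wf_rule (ts, t, r)" "R 2 = 1"
  shows "wp w (rule_cmd (ts, t, r)) (6 * length ts + 5)
    (\<lambda>R'. marks R' = apply_rule R (marks R) (ts, t, r) \<and> agree {12, 13} R R') R"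
  using assms
proof (induction ts arbitrary: R)
  case Nil
  let ?R = "R(13 := 16 + t, 12 := 16 + 4 * R r + t)"
  have "run_block w (address t r @ [Store 12 2]) R = ?R(16 + 4 * R r + t := 1)"
    using Nil.prems(2) by (simp add: run_block_append run_address)
  moreover have "marks (?R(16 + 4 * R r + t := 1)) = insert (t, R r) (marks R)"
    using Nil.prems(1) by (subst marks_set) simp_all
  moreover have "agree {12, 13} R (?R(16 + 4 * R r + t := 1))"
    by (simp del: fun_upd_apply)
  ultimately show ?case
    by (auto intro!: wp_Block simp del: run_block_simps fun_upd_apply)
next
  case (Cons \<tau> ts)
  let ?R = "run_block w (code_of_test \<tau>) R"
  have \<tau>: "wf_test \<tau>" using Cons.prems by simp
  note test = run_code_of_test[of \<tau> R w, OF \<tau> Cons.prems(2)]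
  have regs: "\<forall>i \<in> var_regs. ?R i = R i"
    using agree_vars[OF test(2)] .
  have "?R 2 = 1" using agreeD[OF test(2), of 2] Cons.prems(2) by simp
  then have "wp w (rule_cmd (ts, t, r)) (6 * length ts + 5)
      (\<lambda>R'. marks R' = apply_rule ?R (marks ?R) (ts, t, r) \<and> agree {12, 13} ?R R') ?R"
    using Cons.IH[of ?R] Cons.prems(1) by simp
  moreover have "apply_rule ?R (marks ?R) (ts, t, r) = apply_rule R (marks R) (ts, t, r)"
    unfolding test(3) using Cons.prems(1) by (intro apply_rule_cong regs) simp
  ultimately have body: "wp w (rule_cmd (ts, t, r)) (6 * length ts + 5)
      (\<lambda>R'. marks R' = apply_rule R (marks R) (ts, t, r) \<and> agree {12, 13} ?R R') ?R"
    by (simp only:)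
  have "wp w (rule_cmd (\<tau> # ts, t, r)) (5 + Suc (6 * length ts + 5))
    (\<lambda>R'. marks R' = apply_rule R (marks R) (\<tau> # ts, t, r) \<and> agree {12, 13} R R') R"
    unfolding rule_cmd.simps
  proof (rule wp_Seq[where \<Psi> = "\<lambda>R'. R' = ?R"])
    show "wp w (Block (code_of_test \<tau>)) 5 (\<lambda>R'. R' = ?R) R"
      using code_of_test_no_jump by (intro wp_Block) auto
  next
    fix R' assume R': "R' = ?R"
    show "wp w (If_nonzero 12 (rule_cmd (ts, t, r))) (Suc (6 * length ts + 5))
        (\<lambda>R'. marks R' = apply_rule R (marks R) (\<tau> # ts, t, r) \<and> agree {12, 13} R R') R'"
      unfolding R'
    proof (rule wp_If)
      assume "?R 12 \<noteq> 0"
      then have "holds R (marks R) \<tau>" using test by simp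
      then show "wp w (rule_cmd (ts, t, r)) (6 * length ts + 5)
          (\<lambda>R'. marks R' = apply_rule R (marks R) (\<tau> # ts, t, r) \<and> agree {12, 13} R R') ?R"
      proof (intro wp_mono[OF body] order_refl)
        fix R' assume "marks R' = apply_rule R (marks R) (ts, t, r) \<and> agree {12, 13} ?R R'"
        then show "marks R' = apply_rule R (marks R) (\<tau> # ts, t, r) \<and> agree {12, 13} R R'"
          using \<open>holds R (marks R) \<tau>\<close> agree_trans[OF test(2), of R'] by simp
      qed
    next
      assume "?R 12 = 0"
      then show "marks ?R = apply_rule R (marks R) (\<tau> # ts, t, r) \<and> agree {12, 13} R ?R"
        using test by simp
    qed
  qed
  then show ?case by (rule wp_mono) auto
qed

fun rules_cmd :: "rule list \<Rightarrow> cmd" where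
  "rules_cmd [] = Block []"
| "rules_cmd (\<rho> # rs) = Seq (rule_cmd \<rho>) (rules_cmd rs)"

definition rules_cost :: "rule list \<Rightarrow> nat" where
  "rules_cost rs = (\<Sum>\<rho>\<leftarrow>rs. 6 * length (fst \<rho>) + 5)"

lemma foldl_apply_rule_cong:
  "\<forall>\<rho> \<in> set rs. wf_rule \<rho> \<Longrightarrow> \<forall>i \<in> var_regs. V i = V' i \<Longrightarrow>
   foldl (apply_rule V) S rs = foldl (apply_rule V') S rs"
  using apply_rule_cong by (intro foldl_cong) auto

lemma wp_rules_cmd:
  assumes "\<forall>\<rho> \<in> set rs. wf_rule \<rho>" "R 2 = 1"
  shows "wp w (rules_cmd rs) (rules_cost rs)
    (\<lambda>R'. marks R' = foldl (apply_rule R) (marks R) rs \<and> agree {12, 13} R R') R"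
  using assms
proof (induction rs arbitrary: R)
  case Nil
  then show ?case by (auto intro!: wp_Block)
next
  case (Cons \<rho> rs)
  have *: "wp w (rule_cmd \<rho>) (6 * length (fst \<rho>) + 5)
    (\<lambda>R'. marks R' = apply_rule R (marks R) \<rho> \<and> agree {12, 13} R R') R"
    using wp_rule_cmd[of "fst \<rho>" "fst (snd \<rho>)" "snd (snd \<rho>)" R w] Cons.prems by simp
  have "wp w (rules_cmd (\<rho> # rs)) ((6 * length (fst \<rho>) + 5) + rules_cost rs)
    (\<lambda>R'. marks R' = foldl (apply_rule R) (marks R) (\<rho> # rs) \<and> agree {12, 13} R R') R"
    unfolding rules_cmd.simps
  proof (rule wp_Seq[OF *])
    fix R' assume R': "marks R' = apply_rule R (marks R) \<rho> \<and> agree {12, 13} R R'"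
    have "\<forall>i \<in> var_regs. R' i = R i" using R' agree_vars by blast
    then have "foldl (apply_rule R') S rs = foldl (apply_rule R) S rs" for S
      using foldl_apply_rule_cong[of rs R' R S] Cons.prems(1) by simp
    moreover have "R' 2 = 1" using R' agreeD[of "{12, 13}" R R' 2] Cons.prems by simp
    ultimately have "wp w (rules_cmd rs) (rules_cost rs)
      (\<lambda>R''. marks R'' = foldl (apply_rule R) (marks R') rs \<and> agree {12, 13} R' R'') R'"
      using Cons.IH[of R'] Cons.prems(1) by simp
    then show "wp w (rules_cmd rs) (rules_cost rs)
      (\<lambda>R'. marks R' = foldl (apply_rule R) (marks R) (\<rho> # rs) \<and> agree {12, 13} R R') R'"
    proof (rule wp_mono)
      fix R'' assume "marks R'' = foldl (apply_rule R) (marks R') rs \<and> agree {12, 13} R' R''"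
      then show "marks R'' = foldl (apply_rule R) (marks R) (\<rho> # rs) \<and> agree {12, 13} R R''"
        using R' agree_trans[of "{12, 13}" R R' R''] by simp
    qed simp
  qed
  then show ?case by (simp add: rules_cost_def)
qed

text \<open>The tags 0, 1, 2, 3 mark \<^const>\<open>fwd\<close>, \<^const>\<open>bwd\<close>, \<^const>\<open>wcomp\<close> and \<^const>\<open>reach_avoid\<close>.\<close>
definition rules :: "rule list" where
  "rules =
    [([Same 9 3, Diff 10 3, Diff 10 4], 0, 10),
     ([Marked 0 9, Diff 10 3, Diff 10 4], 0, 10),
     ([Same 10 4, Diff 9 3, Diff 9 4], 1, 9),
     ([Marked 1 10, Diff 9 3, Diff 9 4], 1, 9),
     ([Marked 0 5, Marked 1 5], 2, 5),
     ([Marked 2 9, Marked 0 10, Marked 1 10], 2, 10),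
     ([Marked 2 10, Marked 0 9, Marked 1 9], 2, 9),
     ([Same 9 3, Marked 2 10, Diff 10 6], 3, 10),
     ([Marked 3 9, Marked 2 10, Diff 10 6], 3, 10),
     ([Marked 3 9, Same 10 4, Diff 3 4], 3, 4)]"

lemma wf_rules: "\<forall>\<rho> \<in> set rules. wf_rule \<rho>"
  by (simp add: rules_def var_regs_def)

section \<open>The least model of the Horn rules by iterated passes\<close>

definition val :: "nat \<Rightarrow> nat \<Rightarrow> nat \<Rightarrow> nat \<Rightarrow> nat \<times> nat \<Rightarrow> nat \<Rightarrow> nat" where
  "val a d k x e = (\<lambda>_. 0)(3 := a, 4 := d, 5 := k, 6 := x, 9 := fst e, 10 := snd e)"

definition facts :: "(nat \<times> nat) set \<Rightarrow> nat \<Rightarrow> nat \<Rightarrow> nat \<Rightarrow> nat \<Rightarrow> (nat \<times> nat) set" where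
  "facts E a d k x = {(t, v). t = 0 \<and> fwd E a d v \<or> t = 1 \<and> bwd E a d v \<or>
     t = 2 \<and> wcomp E a d k v \<or> t = 3 \<and> reach_avoid E a d k x v}"

definition rules_closed :: "(nat \<Rightarrow> nat) \<Rightarrow> (nat \<times> nat) set \<Rightarrow> bool" where
  "rules_closed V S \<longleftrightarrow> (\<forall>\<rho> \<in> set rules. apply_rule V S \<rho> \<subseteq> S)"

lemma rules_closed_iff:
  "rules_closed (val a d k x (u, v)) S \<longleftrightarrow>
    (u = a \<and> v \<noteq> a \<and> v \<noteq> d \<longrightarrow> (0, v) \<in> S) \<and>
    ((0, u) \<in> S \<and> v \<noteq> a \<and> v \<noteq> d \<longrightarrow> (0, v) \<in> S) \<and>
    (v = d \<and> u \<noteq> a \<and> u \<noteq> d \<longrightarrow> (1, u) \<in> S) \<and>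
    ((1, v) \<in> S \<and> u \<noteq> a \<and> u \<noteq> d \<longrightarrow> (1, u) \<in> S) \<and>
    ((0, k) \<in> S \<and> (1, k) \<in> S \<longrightarrow> (2, k) \<in> S) \<and>
    ((2, u) \<in> S \<and> (0, v) \<in> S \<and> (1, v) \<in> S \<longrightarrow> (2, v) \<in> S) \<and>
    ((2, v) \<in> S \<and> (0, u) \<in> S \<and> (1, u) \<in> S \<longrightarrow> (2, u) \<in> S) \<and>
    (u = a \<and> (2, v) \<in> S \<and> v \<noteq> x \<longrightarrow> (3, v) \<in> S) \<and>
    ((3, u) \<in> S \<and> (2, v) \<in> S \<and> v \<noteq> x \<longrightarrow> (3, v) \<in> S) \<and>
    ((3, u) \<in> S \<and> v = d \<and> a \<noteq> d \<longrightarrow> (3, d) \<in> S)"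
proof -
  have *: "apply_rule V S (ts, t, r) \<subseteq> S \<longleftrightarrow> ((\<forall>\<tau> \<in> set ts. holds V S \<tau>) \<longrightarrow> (t, V r) \<in> S)"
    for V :: "nat \<Rightarrow> nat" and ts t r
    by (cases "\<forall>\<tau> \<in> set ts. holds V S \<tau>") auto
  show ?thesis
    unfolding rules_closed_def rules_def list.set ball_simps * 
    by (simp add: val_def)
qed

lemma rules_closed_facts:
  assumes "(u, v) \<in> E"
  shows "rules_closed (val a d k x (u, v)) (facts E a d k x)"
proof -
  have "fwd E a d v" if "u = a \<or> fwd E a d u" "v \<noteq> a" "v \<noteq> d"
    using that assms by (blast intro: fwd.intros)
  moreover have "bwd E a d u" if "v = d \<or> bwd E a d v" "u \<noteq> a" "u \<noteq> d"
    using that assms by (blast intro: bwd.intros)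
  moreover have "wcomp E a d k v" if "wcomp E a d k u" "fwd E a d v" "bwd E a d v"
    using that assms by (blast intro: wcomp.intros)
  moreover have "wcomp E a d k u" if "wcomp E a d k v" "fwd E a d u" "bwd E a d u"
    using that assms by (blast intro: wcomp.intros)
  moreover have "wcomp E a d k k" if "fwd E a d k" "bwd E a d k"
    using that by (blast intro: wcomp.intros)
  moreover have "reach_avoid E a d k x v" if "u = a \<or> reach_avoid E a d k x u" "wcomp E a d k v" "v \<noteq> x"
    using that assms by (blast intro: reach_avoid.intros)
  moreover have "reach_avoid E a d k x d" if "reach_avoid E a d k x u" "v = d" "a \<noteq> d"
    using that assms by (blast intro: reach_avoid.intros)
  ultimately show ?thesis
    unfolding rules_closed_iff facts_def by simp
qed

lemma facts_least:
  assumes "E \<noteq> {}" and closed: "\<And>e. e \<in> E \<Longrightarrow> rules_closed (val a d k x e) S"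
  shows "facts E a d k x \<subseteq> S"
proof -
  have cl: "rules_closed (val a d k x (u, v)) S" if "(u, v) \<in> E" for u v
    using closed that by blast
  note cl' = cl[unfolded rules_closed_iff]
  \<comment> \<open>The clause that puts k into its own component mentions no arc; it is read off
    from an arbitrary one.\<close>
  obtain u0 v0 where "(u0, v0) \<in> E" using assms(1) by auto
  note k = cl'[OF this]
  have f: "(0, v) \<in> S" if "fwd E a d v" for v
    using that
  proof induction
    case (fwd_start v)
    then show ?case using cl'[OF fwd_start(1)] by simp
  next
    case (fwd_step u v)
    then show ?case using cl'[OF fwd_step(2)] by simp
  qed
  have b: "(1, v) \<in> S" if "bwd E a d v" for v
    using that
  proof induction
    case (bwd_start u)
    then show ?case using cl'[OF bwd_start(1)] by simp
  next
    case (bwd_step v u)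
    then show ?case using cl'[OF bwd_step(2)] by simp
  qed
  have c: "(2, v) \<in> S" if "wcomp E a d k v" for v
    using that
  proof induction
    case wcomp_start
    with k f b show ?case by simp
  next
    case (wcomp_out u v)
    then show ?case using cl'[OF wcomp_out(2)] f[of v] b[of v] by simp
  next
    case (wcomp_in v u)
    then show ?case using cl'[OF wcomp_in(2)] f[of u] b[of u] by simp
  qed
  have "(3, v) \<in> S" if "reach_avoid E a d k x v" for v
    using that
  proof induction
    case (avoid_start v)
    then show ?case using cl'[OF avoid_start(1)] c[of v] by simp
  next
    case (avoid_step u v)
    then show ?case using cl'[OF avoid_step(2)] c[of v] by simp
  next
    case (avoid_end u)
    then show ?case using cl'[OF avoid_end(2)] by simp
  qed
  with f b c show ?thesis unfolding facts_def by blast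
qed

definition arc_step :: "nat \<Rightarrow> nat \<Rightarrow> nat \<Rightarrow> nat \<Rightarrow> (nat \<times> nat) set \<Rightarrow> nat \<times> nat \<Rightarrow> (nat \<times> nat) set" where
  "arc_step a d k x S e = foldl (apply_rule (val a d k x e)) S rules"

text \<open>Marks are updated in place, so later arcs already see the marks set earlier in the same
  pass. This is sound because rules only add consequences.\<close>

definition pass :: "nat \<Rightarrow> nat \<Rightarrow> nat \<Rightarrow> nat \<Rightarrow> (nat \<times> nat) list \<Rightarrow> (nat \<times> nat) set \<Rightarrow> (nat \<times> nat) set" where
  "pass a d k x es S = foldl (arc_step a d k x) S es"

lemma foldl_extensive:
  fixes f :: "'a set \<Rightarrow> 'b \<Rightarrow> 'a set"
  assumes "\<And>S y. S \<subseteq> f S y"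
  shows "S \<subseteq> foldl f S ys"
proof (induction ys arbitrary: S)
  case (Cons y ys)
  show ?case using assms[of S y] Cons[of "f S y"] by simp
qed simp

text \<open>Steps never remove anything, so a whole round without gain consists of steps without
  gain.\<close>

lemma foldl_extensive_fixed:
  fixes f :: "'a set \<Rightarrow> 'b \<Rightarrow> 'a set"
  assumes "\<And>S y. S \<subseteq> f S y"
  shows "foldl f S ys \<subseteq> S \<Longrightarrow> y \<in> set ys \<Longrightarrow> f S y \<subseteq> S"
proof (induction ys)
  case (Cons z ys)
  have "f S z \<subseteq> foldl f (f S z) ys" using foldl_extensive[of f] assms by blast
  with Cons.prems(1) have "f S z \<subseteq> S" by simp
  then have "f S z = S" using assms by blast
  with Cons show ?case by auto
qed simp

lemma foldl_bounded:
  fixes f :: "'a set \<Rightarrow> 'b \<Rightarrow> 'a set"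
  assumes "\<And>S y. y \<in> set ys \<Longrightarrow> S \<subseteq> F \<Longrightarrow> f S y \<subseteq> F"
  shows "S \<subseteq> F \<Longrightarrow> foldl f S ys \<subseteq> F"
  using assms by (induction ys arbitrary: S) simp_all

lemma apply_rule_extensive: "S \<subseteq> apply_rule V S \<rho>"
  by (cases \<rho>) auto

lemma holds_mono: "holds V S \<tau> \<Longrightarrow> S \<subseteq> S' \<Longrightarrow> holds V S' \<tau>"
  by (cases \<tau>) auto

lemma apply_rule_mono: "S \<subseteq> S' \<Longrightarrow> apply_rule V S \<rho> \<subseteq> apply_rule V S' \<rho>"
  using holds_mono[of V S _ S'] by (cases \<rho>) auto

lemma arc_step_extensive: "S \<subseteq> arc_step a d k x S e"
  unfolding arc_step_def by (rule foldl_extensive[OF apply_rule_extensive])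

lemma pass_extensive: "S \<subseteq> pass a d k x es S"
  unfolding pass_def by (rule foldl_extensive[OF arc_step_extensive])

lemma pass_facts:
  assumes "S \<subseteq> facts (set es) a d k x"
  shows "pass a d k x es S \<subseteq> facts (set es) a d k x"
  unfolding pass_def
proof (rule foldl_bounded[OF _ assms])
  fix S e assume e: "e \<in> set es" and S: "S \<subseteq> facts (set es) a d k x"
  have closed: "rules_closed (val a d k x e) (facts (set es) a d k x)"
    using rules_closed_facts[of "fst e" "snd e"] e by simp
  show "arc_step a d k x S e \<subseteq> facts (set es) a d k x"
    unfolding arc_step_def
  proof (rule foldl_bounded[OF _ S])
    fix S \<rho> assume "\<rho> \<in> set rules" "S \<subseteq> facts (set es) a d k x"
    then show "apply_rule (val a d k x e) S \<rho> \<subseteq> facts (set es) a d k x"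
      using apply_rule_mono[of S "facts (set es) a d k x" "val a d k x e" \<rho>] closed
      unfolding rules_closed_def by blast
  qed
qed

lemma pass_fixed_closed:
  assumes "pass a d k x es S \<subseteq> S" "e \<in> set es"
  shows "rules_closed (val a d k x e) S"
proof -
  have "arc_step a d k x S e \<subseteq> S"
    using foldl_extensive_fixed[of "arc_step a d k x", OF arc_step_extensive] assms
    unfolding pass_def by blast
  then show ?thesis
    using foldl_extensive_fixed[of "apply_rule (val a d k x e)", OF apply_rule_extensive]
    unfolding arc_step_def rules_closed_def by blast
qed

text \<open>If the n-th iterate were not fixed, no earlier one would be either. Then each of the
  first n + 1 applications gains an element, which is more than U can hold.\<close>

lemma iterate_extensive_fixed:
  fixes f :: "'a set \<Rightarrow> 'a set"
  assumes ext: "\<And>S. S \<subseteq> f S" and U: "\<And>i. (f ^^ i) {} \<subseteq> U" and "finite U" "card U \<le> n"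
  shows "f ((f ^^ n) {}) = (f ^^ n) {}"
proof (rule ccontr)
  assume *: "f ((f ^^ n) {}) \<noteq> (f ^^ n) {}"
  have "i \<le> card ((f ^^ i) {})" if "i \<le> Suc n" for i
    using that
  proof (induction i)
    case (Suc i)
    have "f ((f ^^ i) {}) \<noteq> (f ^^ i) {}"
    proof
      assume fx: "f ((f ^^ i) {}) = (f ^^ i) {}"
      have "(f ^^ (j + i)) {} = (f ^^ i) {}" for j
        by (induction j) (use fx in simp_all)
      from this[of "n - i"] have "(f ^^ n) {} = (f ^^ i) {}" using Suc.prems by simp
      with fx * show False by simp
    qed
    then have "(f ^^ i) {} \<subset> (f ^^ Suc i) {}" using ext[of "(f ^^ i) {}"] by auto
    moreover have "finite ((f ^^ Suc i) {})" using U assms(3) by (rule finite_subset)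
    ultimately have "card ((f ^^ i) {}) < card ((f ^^ Suc i) {})" by (rule psubset_card_mono[rotated])
    with Suc show ?case by simp
  qed simp
  from this[of "Suc n"] have "Suc n \<le> card ((f ^^ Suc n) {})" by simp
  also have "\<dots> \<le> card U" by (rule card_mono[OF assms(3) U])
  finally show False using assms(4) by simp
qed

lemma facts_bound: "Field E \<subseteq> {..M} \<Longrightarrow> facts E a d k x \<subseteq> {..<4::nat} \<times> {..M}"
proof -
  assume E: "Field E \<subseteq> {..M}"
  have arc: "u \<le> M" "v \<le> M" if "(u, v) \<in> E" for u v
    using that E by (auto simp: Field_def)
  have f: "v \<le> M" if "fwd E a d v" for v using that by cases (auto dest: arc)
  have b: "v \<le> M" if "bwd E a d v" for v using that by cases (auto dest: arc)
  have c: "v \<le> M" if "wcomp E a d k v" for v using wcomp_fwd_bwd[OF that] f by blast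
  have "v \<le> M" if "reach_avoid E a d k x v" for v using that by cases (auto dest: arc)
  with f b c show ?thesis unfolding facts_def by auto
qed

text \<open>The number of passes is the number of conceivable marks: four tags on the nodes 0 to
  M.\<close>

theorem pass_iterate:
  assumes "es \<noteq> []" "Field (set es) \<subseteq> {..M}"
  shows "(pass a d k x es ^^ (4 * (M + 1))) {} = facts (set es) a d k x"
proof
  let ?f = "pass a d k x es" and ?F = "facts (set es) a d k x"
  have sound: "(?f ^^ i) {} \<subseteq> ?F" for i
    by (induction i) (simp_all add: pass_facts)
  then show "(?f ^^ (4 * (M + 1))) {} \<subseteq> ?F" .
  have "?F \<subseteq> {..<4::nat} \<times> {..M}" by (rule facts_bound[OF assms(2)])
  then have "(?f ^^ i) {} \<subseteq> {..<4::nat} \<times> {..M}" for i using sound by (rule order_trans[rotated])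
  moreover have U: "finite ({..<4::nat} \<times> {..M})" "card ({..<4::nat} \<times> {..M}) = 4 * (M + 1)"
    by (simp_all add: card_cartesian_product)
  ultimately have "?f ((?f ^^ (4 * (M + 1))) {}) = (?f ^^ (4 * (M + 1))) {}"
    by (intro iterate_extensive_fixed[OF pass_extensive _ U(1)]) simp_all
  then show "?F \<subseteq> (?f ^^ (4 * (M + 1))) {}"
    using assms(1) by (intro facts_least pass_fixed_closed[of _ _ _ _ es]) simp_all
qed

section \<open>The program\<close>

text \<open>Here \<open>4 * v + t\<close> is the offset of a mark from cell 16, so the bound says
  that erasing N cells erases all marks left over from an earlier choice of a, d, k, x.\<close>

definition mark_bound :: "nat \<Rightarrow> (nat \<times> nat) set" where
  "mark_bound N = {(t, v). 4 * v + t < N}"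

definition base :: "nat \<Rightarrow> (nat \<Rightarrow> nat) \<Rightarrow> bool" where
  "base N R \<longleftrightarrow> R 14 = N \<and> R 2 = 1 \<and> R 15 = 0 \<and> marks R \<subseteq> mark_bound N"

lemma base_upd [simp]: "i < 14 \<Longrightarrow> i \<noteq> 2 \<Longrightarrow> base N (R(i := y)) = base N R"
  by (simp add: base_def)

lemma base_agree:
  assumes "base N R" "agree W R R'" "W \<subseteq> {..<14} - {2}" "marks R' \<subseteq> mark_bound N"
  shows "base N R'"
proof -
  have "R' 14 = R 14" "R' 2 = R 2" "R' 15 = R 15"
    using assms(3) by (auto intro!: agreeD[OF assms(2)])
  then show ?thesis using assms by (simp add: base_def)
qed

definition clear_cmd :: cmd where
  "clear_cmd = For 7 (Block [Const 12 16, Add 12 12 7, Store 12 15])"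

lemma marks_clear: "marks (R(16 + i := 0)) = marks R - {(t, v). 4 * v + t = i}"
  by (auto simp: marks_def)

lemma wp_clear_cmd:
  assumes "base N R"
  shows "wp w clear_cmd (3 + N * 7) (\<lambda>R'. marks R' = {} \<and> agree {7, 12, 13} R R') R"
proof -
  let ?I = "\<lambda>j R'. agree {7, 12, 13} R R' \<and> marks R' \<subseteq> {(t, v). j \<le> 4 * v + t \<and> 4 * v + t < N}"
  have "wp w clear_cmd (3 + N * (3 + 4)) (\<lambda>R'. marks R' = {} \<and> agree {7, 12, 13} R R') R"
    unfolding clear_cmd_def
  proof (rule wp_For[where I = ?I])
    show "?I 0 (R(7 := 0, 13 := N))"
      using assms by (auto simp: base_def mark_bound_def)
  next
    fix j R' assume R': "j < N" "?I j R'" "R' 7 = j" "R' 14 = N" "R' 2 = 1"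
    have "R' 15 = 0" using R'(2) assms agreeD[of "{7, 12, 13}" R R' 15] by (simp add: base_def)
    then have eff: "run_block w [Const 12 16, Add 12 12 7, Store 12 15] R' = R'(12 := 16 + j, 16 + j := 0)"
      using R'(3) by simp
    have "marks (R'(12 := 16 + j, 16 + j := 0)) \<subseteq> {(t, v). Suc j \<le> 4 * v + t \<and> 4 * v + t < N}"
      using R'(2) by (subst marks_clear) auto
    moreover have "agree {7, 12, 13} R (R'(12 := 16 + j, 16 + j := 0))"
      using R'(2) by (simp del: fun_upd_apply)
    ultimately show "wp w (Block [Const 12 16, Add 12 12 7, Store 12 15]) 3
        (\<lambda>R''. R'' 7 = j \<and> R'' 14 = N \<and> R'' 2 = 1 \<and> ?I (Suc j) (R''(7 := Suc j, 13 := N - Suc j))) R'"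
      using R' by (intro wp_Block) (simp_all add: eff del: run_block_simps)
  next
    fix R' assume "?I N R'"
    then show "marks R' = {} \<and> agree {7, 12, 13} R R'" by auto
  qed (use assms in \<open>simp_all add: base_def\<close>)
  then show ?thesis by simp
qed

definition input :: "nat list \<Rightarrow> nat \<Rightarrow> nat" where
  "input w i = (if i < length w then w ! i else 0)"

text \<open>The offset 2 skips the two leading counts.\<close>

definition input_arc :: "nat list \<Rightarrow> nat \<Rightarrow> nat \<times> nat" where
  "input_arc w j = (input w (2 * j + 2), input w (2 * j + 3))"

definition arc_cmd :: cmd where
  "arc_cmd = Seq (Block [Add 12 8 8, Add 12 12 2, Add 12 12 2, Read 9 12, Add 12 12 2, Read 10 12])
     (rules_cmd rules)"

lemma wp_arc_cmd:
  assumes "R 2 = 1" "R 8 = j"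
  shows "wp w arc_cmd (6 + rules_cost rules)
    (\<lambda>R'. marks R' = arc_step (R 3) (R 4) (R 5) (R 6) (marks R) (input_arc w j) \<and>
      agree {9, 10, 12, 13} R R') R"
proof -
  let ?xs = "[Add 12 8 8, Add 12 12 2, Add 12 12 2, Read 9 12, Add 12 12 2, Read 10 12]"
  let ?R = "R(12 := 2 * j + 3, 9 := fst (input_arc w j), 10 := snd (input_arc w j))"
  have eff: "run_block w ?xs R = ?R"
    using assms by (simp add: input_arc_def input_def fun_eq_iff numeral_eq_Suc)
  have R: "agree {9, 10, 12, 13} R ?R" by (simp del: fun_upd_apply)
  have "wp w (rules_cmd rules) (rules_cost rules)
      (\<lambda>R'. marks R' = foldl (apply_rule ?R) (marks ?R) rules \<and> agree {12, 13} ?R R') ?R"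
    using assms by (intro wp_rules_cmd wf_rules) simp
  moreover have "foldl (apply_rule ?R) (marks ?R) rules =
      arc_step (R 3) (R 4) (R 5) (R 6) (marks R) (input_arc w j)"
    unfolding arc_step_def
    by (subst foldl_apply_rule_cong[OF wf_rules, of ?R "val (R 3) (R 4) (R 5) (R 6) (input_arc w j)"])
      (simp_all add: var_regs_def val_def)
  ultimately have *: "wp w (rules_cmd rules) (rules_cost rules)
      (\<lambda>R'. marks R' = arc_step (R 3) (R 4) (R 5) (R 6) (marks R) (input_arc w j) \<and> agree {12, 13} ?R R') ?R"
    by (simp only:)
  show ?thesis
    unfolding arc_cmd_def
  proof (rule wp_Seq[where \<Psi> = "\<lambda>R'. R' = ?R"])
    show "wp w (Block ?xs) 6 (\<lambda>R'. R' = ?R) R"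
      using eff by (intro wp_Block) (simp_all del: run_block_simps)
  next
    fix R' assume R': "R' = ?R"
    show "wp w (rules_cmd rules) (rules_cost rules)
      (\<lambda>R'. marks R' = arc_step (R 3) (R 4) (R 5) (R 6) (marks R) (input_arc w j) \<and>
        agree {9, 10, 12, 13} R R') R'"
      unfolding R'
    proof (intro wp_mono[OF * order_refl])
      fix R'' assume R'': "marks R'' = arc_step (R 3) (R 4) (R 5) (R 6) (marks R) (input_arc w j) \<and>
        agree {12, 13} ?R R''"
      then have "agree {9, 10, 12, 13} ?R R''" by (blast intro: agree_mono)
      with R R'' show "marks R'' = arc_step (R 3) (R 4) (R 5) (R 6) (marks R) (input_arc w j) \<and>
        agree {9, 10, 12, 13} R R''" by (blast intro: agree_trans)
    qed
  qed
qed

definition arc_time :: nat where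
  "arc_time = 6 + rules_cost rules"

definition pass_time :: "nat \<Rightarrow> nat" where
  "pass_time N = 3 + N * (arc_time + 4)"

lemma wp_pass_cmd:
  assumes "base N R"
  shows "wp w (For 8 arc_cmd) (pass_time N)
    (\<lambda>R'. marks R' = pass (R 3) (R 4) (R 5) (R 6) (map (input_arc w) [0..<N]) (marks R) \<and>
      agree {8, 9, 10, 12, 13} R R') R"
proof -
  let ?W = "{8, 9, 10, 12, 13}"
  let ?S = "\<lambda>j. pass (R 3) (R 4) (R 5) (R 6) (map (input_arc w) [0..<j]) (marks R)"
  let ?I = "\<lambda>j R'. marks R' = ?S j \<and> agree ?W R R'"
  show ?thesis
    unfolding pass_time_def
  proof (rule wp_For[where I = ?I])
    show "?I 0 (R(8 := 0, 13 := N))" by (simp add: pass_def del: fun_upd_apply)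
  next
    fix j R' assume R': "j < N" "?I j R'" "R' 8 = j" "R' 14 = N" "R' 2 = 1"
    have eq: "R' 3 = R 3" "R' 4 = R 4" "R' 5 = R 5" "R' 6 = R 6"
      using R'(2) agreeD[of ?W R R'] by simp_all
    have step: "arc_step (R 3) (R 4) (R 5) (R 6) (?S j) (input_arc w j) = ?S (Suc j)"
      by (simp add: pass_def)
    have *: "wp w arc_cmd arc_time (\<lambda>R''. marks R'' = ?S (Suc j) \<and> agree {9, 10, 12, 13} R' R'') R'"
      using wp_arc_cmd[of R' j w, OF R'(5,3)] R'(2) unfolding eq arc_time_def step[symmetric] by simp
    show "wp w arc_cmd arc_time (\<lambda>R''. R'' 8 = j \<and> R'' 14 = N \<and> R'' 2 = 1 \<and>
        ?I (Suc j) (R''(8 := Suc j, 13 := N - Suc j))) R'"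
    proof (rule wp_mono[OF * order_refl])
      fix R'' assume R'': "marks R'' = ?S (Suc j) \<and> agree {9, 10, 12, 13} R' R''"
      have "R'' 8 = j" "R'' 14 = N" "R'' 2 = 1"
        using R'' R' agreeD[of "{9, 10, 12, 13}" R' R''] by simp_all
      moreover have "agree ?W R' R''" using R'' by (blast intro: agree_mono)
      then have "agree ?W R R''" using R'(2) by (blast intro: agree_trans)
      ultimately show "R'' 8 = j \<and> R'' 14 = N \<and> R'' 2 = 1 \<and>
          ?I (Suc j) (R''(8 := Suc j, 13 := N - Suc j))"
        using R'' by (simp del: fun_upd_apply upt_Suc)
    qed
  next
    fix R' assume "?I N R'"
    then show "?I N R'" .
  qed (use assms in \<open>simp_all add: base_def\<close>)
qed

definition closure_cmd :: cmd where
  "closure_cmd = Seq clear_cmd (For 7 (For 8 arc_cmd))"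

definition closure_time :: "nat \<Rightarrow> nat" where
  "closure_time N = 3 + N * 7 + (3 + N * (pass_time N + 4))"

lemma wp_closure_cmd:
  assumes "base N R" and N: "N = 4 * (M + 1)"
    and es: "es = map (input_arc w) [0..<N]" "Field (set es) \<subseteq> {..M}"
  shows "wp w closure_cmd (closure_time N)
    (\<lambda>R'. marks R' = facts (set es) (R 3) (R 4) (R 5) (R 6) \<and> agree {7, 8, 9, 10, 12, 13} R R') R"
  unfolding closure_cmd_def closure_time_def
proof (rule wp_Seq[OF wp_clear_cmd[OF assms(1)]])
  fix R1 assume R1: "marks R1 = {} \<and> agree {7, 12, 13} R R1"
  let ?W = "{7, 8, 9, 10, 12, 13}"
  let ?S = "\<lambda>i. (pass (R 3) (R 4) (R 5) (R 6) es ^^ i) {}"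
  let ?I = "\<lambda>i R'. marks R' = ?S i \<and> agree ?W R R'"
  have "es \<noteq> []" using es N by simp
  then have final: "?S N = facts (set es) (R 3) (R 4) (R 5) (R 6)"
    unfolding N by (rule pass_iterate[OF _ es(2)])
  have R1W: "agree ?W R R1" using R1 by (blast intro: agree_mono)
  show "wp w (For 7 (For 8 arc_cmd)) (3 + N * (pass_time N + 4))
      (\<lambda>R'. marks R' = facts (set es) (R 3) (R 4) (R 5) (R 6) \<and> agree ?W R R') R1"
    unfolding final[symmetric]
  proof (rule wp_For[where I = ?I])
    show "R1 14 = N" "R1 2 = 1"
      using assms(1) R1 agreeD[of "{7, 12, 13}" R R1] by (simp_all add: base_def)
    show "?I 0 (R1(7 := 0, 13 := N))" using R1 R1W by (simp del: fun_upd_apply)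
  next
    fix i R' assume R': "i < N" "?I i R'" "R' 7 = i" "R' 14 = N" "R' 2 = 1"
    have eq: "R' 3 = R 3" "R' 4 = R 4" "R' 5 = R 5" "R' 6 = R 6" "R' 15 = R 15"
      using R'(2) agreeD[of ?W R R'] by simp_all
    \<comment> \<open>Intermediate iterates already lie below the least model, so at no time is a
      mark set outside the N cells; this restores \<open>base\<close>.\<close>
    have "?S i \<subseteq> facts (set es) (R 3) (R 4) (R 5) (R 6)"
      by (induction i) (simp_all add: pass_facts)
    also have "\<dots> \<subseteq> {..<4} \<times> {..M}" by (rule facts_bound[OF es(2)])
    also have "\<dots> \<subseteq> mark_bound N" by (auto simp: mark_bound_def N)
    finally have "base N R'" using R' eq assms(1) by (simp add: base_def)
    from wp_pass_cmd[OF this, of w] have *: "wp w (For 8 arc_cmd) (pass_time N)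
        (\<lambda>R''. marks R'' = ?S (Suc i) \<and> agree {8, 9, 10, 12, 13} R' R'') R'"
      using R'(2) unfolding eq es(1) by simp
    show "wp w (For 8 arc_cmd) (pass_time N) (\<lambda>R''. R'' 7 = i \<and> R'' 14 = N \<and> R'' 2 = 1 \<and>
        ?I (Suc i) (R''(7 := Suc i, 13 := N - Suc i))) R'"
    proof (rule wp_mono[OF * order_refl])
      fix R'' assume R'': "marks R'' = ?S (Suc i) \<and> agree {8, 9, 10, 12, 13} R' R''"
      have "R'' 7 = i" "R'' 14 = N" "R'' 2 = 1"
        using R'' R' agreeD[of "{8, 9, 10, 12, 13}" R' R''] by simp_all
      moreover have "agree ?W R' R''" using R'' by (blast intro: agree_mono)
      then have "agree ?W R R''" using R'(2) by (blast intro: agree_trans)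
      ultimately show "R'' 7 = i \<and> R'' 14 = N \<and> R'' 2 = 1 \<and>
          ?I (Suc i) (R''(7 := Suc i, 13 := N - Suc i))"
        using R'' by (simp del: fun_upd_apply funpow.simps)
    qed
  next
    fix R' assume "?I N R'"
    then show "?I N R'" .
  qed simp_all
qed

text \<open>Register 11 tells whether \<open>d\<close> has been reached for all \<open>x\<close> so far.\<close>
definition check_cmd :: cmd where
  "check_cmd = Seq (Block (address 3 4 @ [Load 12 12, Sub 12 2 12])) (If_nonzero 12 (Block [Const 11 0]))"

lemma wp_check_cmd:
  assumes "R 2 = 1"
  shows "wp w check_cmd 8 (\<lambda>R'. R' 11 = (if (3, R 4) \<in> marks R then R 11 else 0) \<and>
    marks R' = marks R \<and> agree {11, 12, 13} R R') R"
proof -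
  let ?xs = "address 3 4 @ [Load 12 12, Sub 12 2 12]"
  \<comment> \<open>The number 19 is the base cell 16 plus the tag 3 of
    \<open>reach_avoid\<close>.\<close>
  let ?R = "R(13 := 19, 12 := 1 - R (19 + 4 * R 4))"
  have eff: "run_block w ?xs R = ?R"
    using assms by (simp add: run_block_append run_address add.commute)
  have mark: "(3, R 4) \<in> marks R \<longleftrightarrow> R (19 + 4 * R 4) \<noteq> 0"
    by (simp add: marks_def add.commute)
  have "wp w check_cmd (6 + Suc 1) (\<lambda>R'. R' 11 = (if (3, R 4) \<in> marks R then R 11 else 0) \<and>
    marks R' = marks R \<and> agree {11, 12, 13} R R') R"
    unfolding check_cmd_def
  proof (rule wp_Seq[where \<Psi> = "\<lambda>R'. R' = ?R"])
    show "wp w (Block ?xs) 6 (\<lambda>R'. R' = ?R) R"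
      using eff by (intro wp_Block) (auto simp del: run_block_simps)
  next
    fix R' assume R': "R' = ?R"
    have "agree {11, 12, 13} R ?R" "agree {11, 12, 13} R (?R(11 := 0))"
      by (simp_all del: fun_upd_apply)
    then show "wp w (If_nonzero 12 (Block [Const 11 0])) (Suc 1)
      (\<lambda>R'. R' 11 = (if (3, R 4) \<in> marks R then R 11 else 0) \<and>
        marks R' = marks R \<and> agree {11, 12, 13} R R') R'"
      unfolding R' mark by (intro wp_If wp_Block) auto
  qed
  then show ?thesis by (rule wp_mono) simp_all
qed

text \<open>Register 0 is written only on success and never reset, so the enclosing loops accumulate
  a disjunction in it.\<close>

definition all_x_cmd :: cmd where
  "all_x_cmd = Seq (Block [Const 11 1]) (Seq (For 6 (Seq closure_cmd check_cmd)) (If_nonzero 11 (Block [Const 0 1])))"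

definition all_x_time :: "nat \<Rightarrow> nat" where
  "all_x_time N = 1 + (3 + N * (closure_time N + 8 + 4) + 2)"

definition all_x :: "(nat \<times> nat) set \<Rightarrow> nat \<Rightarrow> nat \<Rightarrow> nat \<Rightarrow> nat \<Rightarrow> bool" where
  "all_x E N a d k \<longleftrightarrow> (\<forall>x < N. reach_avoid E a d k x d)"

lemma wp_all_x_cmd:
  assumes base: "base N R" and N: "N = 4 * (M + 1)"
    and es: "es = map (input_arc w) [0..<N]" "Field (set es) \<subseteq> {..M}"
  shows "wp w all_x_cmd (all_x_time N)
    (\<lambda>R'. R' 0 = (if all_x (set es) N (R 3) (R 4) (R 5) then 1 else R 0) \<and> base N R' \<and>
      agree {0, 6, 7, 8, 9, 10, 11, 12, 13} R R') R"
proof -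
  let ?W = "{6, 7, 8, 9, 10, 11, 12, 13}"
  let ?P = "\<lambda>x. reach_avoid (set es) (R 3) (R 4) (R 5) x (R 4)"
  let ?I = "\<lambda>j R'. R' 11 = (if \<forall>x < j. ?P x then 1 else 0) \<and> base N R' \<and> agree ?W R R'"
  let ?\<Psi> = "\<lambda>R'. R' 0 = (if all_x (set es) N (R 3) (R 4) (R 5) then 1 else R 0) \<and> base N R' \<and>
      agree {0, 6, 7, 8, 9, 10, 11, 12, 13} R R'"
  have loop: "wp w (For 6 (Seq closure_cmd check_cmd)) (3 + N * (closure_time N + 8 + 4)) (?I N) R1"
    if R1: "R1 = R(11 := 1)" for R1
  proof (rule wp_For[where I = ?I])
    show "?I 0 (R1(6 := 0, 13 := N))" using base by (auto simp: R1 simp del: fun_upd_apply) auto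
    show "R1 14 = N" "R1 2 = 1" using base by (simp_all add: R1 base_def)
  next
    fix j R' assume R': "j < N" "?I j R'" "R' 6 = j" "R' 14 = N" "R' 2 = 1"
    have eq: "R' 3 = R 3" "R' 4 = R 4" "R' 5 = R 5" using R'(2) agreeD[of ?W R R'] by simp_all
    have b: "base N R'" using R'(2) by blast
    show "wp w (Seq closure_cmd check_cmd) (closure_time N + 8)
      (\<lambda>R''. R'' 6 = j \<and> R'' 14 = N \<and> R'' 2 = 1 \<and> ?I (Suc j) (R''(6 := Suc j, 13 := N - Suc j))) R'"
    proof (rule wp_Seq[OF wp_closure_cmd[OF b N es]])
      fix R2 assume "marks R2 = facts (set es) (R' 3) (R' 4) (R' 5) (R' 6) \<and>
        agree {7, 8, 9, 10, 12, 13} R' R2"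
      then have R2: "marks R2 = facts (set es) (R 3) (R 4) (R 5) j" "agree {7, 8, 9, 10, 12, 13} R' R2"
        using R'(3) unfolding eq by simp_all
      have eq2: "R2 2 = 1" "R2 11 = R' 11" "R2 4 = R 4" "R2 6 = j"
        using R' eq agreeD[OF R2(2)] by simp_all
      have bound: "marks R2 \<subseteq> mark_bound N"
        using facts_bound[OF es(2)] unfolding R2(1) by (fastforce simp: mark_bound_def N)
      have b2: "base N R2" by (rule base_agree[OF b R2(2) _ bound]) auto
      have *: "(3, R 4) \<in> marks R2 \<longleftrightarrow> ?P j" unfolding R2(1) facts_def by simp
      show "wp w check_cmd 8 (\<lambda>R''. R'' 6 = j \<and> R'' 14 = N \<and> R'' 2 = 1 \<and>
          ?I (Suc j) (R''(6 := Suc j, 13 := N - Suc j))) R2"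
      proof (rule wp_mono[OF wp_check_cmd[of R2 w, OF eq2(1)] order_refl])
        fix R3 assume R3: "R3 11 = (if (3, R2 4) \<in> marks R2 then R2 11 else 0) \<and>
          marks R3 = marks R2 \<and> agree {11, 12, 13} R2 R3"
        then have b3: "base N R3" using bound by (intro base_agree[OF b2, of "{11, 12, 13}"]) auto
        have "agree ?W R' R2" "agree ?W R2 R3" using R2(2) R3 by (blast intro: agree_mono)+
        then have "agree ?W R R3" using R'(2) by (blast intro: agree_trans)
        moreover have "R3 6 = j" using R3 eq2 agreeD[of "{11, 12, 13}" R2 R3 6] by simp
        moreover have "R3 11 = (if \<forall>x < Suc j. ?P x then 1 else 0)"
          using R3 R'(2) unfolding eq2 * by (auto simp: less_Suc_eq)
        ultimately show "R3 6 = j \<and> R3 14 = N \<and> R3 2 = 1 \<and> ?I (Suc j) (R3(6 := Suc j, 13 := N - Suc j))"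
          using b3 by (simp add: base_def agree_upd del: fun_upd_apply) (simp add: base_def)
      qed
    qed
  next
    fix R' assume "?I N R'"
    then show "?I N R'" .
  qed simp_all
  show ?thesis
    unfolding all_x_cmd_def all_x_time_def
  proof (rule wp_Seq[where \<Psi> = "\<lambda>R'. R' = R(11 := 1)"])
    show "wp w (Block [Const 11 1]) 1 (\<lambda>R'. R' = R(11 := 1)) R"
      by (intro wp_Block) simp_all
  next
    fix R1 assume "R1 = R(11 := 1)"
    show "wp w (Seq (For 6 (Seq closure_cmd check_cmd)) (If_nonzero 11 (Block [Const 0 1])))
       (3 + N * (closure_time N + 8 + 4) + 2) ?\<Psi> R1"
    proof (rule wp_Seq[OF loop[OF \<open>R1 = _\<close>]])
      fix R' assume R': "?I N R'"
      then have "agree {0, 6, 7, 8, 9, 10, 11, 12, 13} R R'" by (blast intro: agree_mono)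
      moreover have "R' 0 = R 0" using R' agreeD[of ?W R R' 0] by simp
      moreover have "R' 11 \<noteq> 0 \<longleftrightarrow> all_x (set es) N (R 3) (R 4) (R 5)"
        using R' unfolding all_x_def by presburger
      moreover have "base N R'" using R' by blast
      ultimately have "R' 11 \<noteq> 0 \<longrightarrow> ?\<Psi> (R'(0 := 1))" "R' 11 = 0 \<longrightarrow> ?\<Psi> R'"
        by auto
      then have "wp w (If_nonzero 11 (Block [Const 0 1])) (Suc 1) ?\<Psi> R'"
        by (intro wp_If wp_Block) (simp_all del: fun_upd_apply)
      then show "wp w (If_nonzero 11 (Block [Const 0 1])) 2 ?\<Psi> R'"
        by (simp only: Suc_1)
    qed
  qed
qed

text \<open>A bounded existential quantifier as a loop. Since i is not in W, the body leaves the
  counter alone; the loop as a whole changes \<open>insert i W\<close>, so it qualifies as the body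
  of the next outer loop.\<close>

lemma wp_search:
  assumes i: "i \<notin> {0, 2}" "i < 13" "i \<notin> W" and W: "{0, 13} \<subseteq> W" and base: "base N R"
    and body: "\<And>j R'. j < N \<Longrightarrow> base N R' \<Longrightarrow> R' i = j \<Longrightarrow> agree (insert i W) R R' \<Longrightarrow>
      wp w c T (\<lambda>R''. R'' 0 = (if P j then 1 else R' 0) \<and> base N R'' \<and> agree W R' R'') R'"
  shows "wp w (For i c) (3 + N * (T + 4))
    (\<lambda>R'. R' 0 = (if \<exists>j < N. P j then 1 else R 0) \<and> base N R' \<and> agree (insert i W) R R') R"
proof (rule wp_For[where I = "\<lambda>j R'. R' 0 = (if \<exists>j' < j. P j' then 1 else R 0) \<and> base N R' \<and>
    agree (insert i W) R R'"])
  let ?I = "\<lambda>j R'. R' 0 = (if \<exists>j' < j. P j' then 1 else R 0) \<and> base N R' \<and> agree (insert i W) R R'"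
  show "i \<notin> {2, 13, 14}" "R 14 = N" "R 2 = 1" using i base by (auto simp: base_def)
  have inv: "?I j (R'(i := y, 13 := z))"
    if "R' 0 = (if \<exists>j' < j. P j' then 1 else R 0)" "base N R'" "agree (insert i W) R R'" for j R' y z
  proof -
    have "(R'(i := y, 13 := z)) 0 = R' 0" using i by simp
    moreover have "base N (R'(i := y, 13 := z))" "agree (insert i W) R (R'(i := y, 13 := z))"
      using that i W by (simp_all del: fun_upd_apply)
    ultimately show ?thesis using that(1) by simp
  qed
  show "?I 0 (R(i := 0, 13 := N))" using base by (intro inv) simp_all
  fix j R' assume R': "j < N" "?I j R'" "R' i = j"
  have *: "wp w c T (\<lambda>R''. R'' 0 = (if P j then 1 else R' 0) \<and> base N R'' \<and> agree W R' R'') R'"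
    using body R' by blast
  show "wp w c T (\<lambda>R''. R'' i = j \<and> R'' 14 = N \<and> R'' 2 = 1 \<and> ?I (Suc j) (R''(i := Suc j, 13 := N - Suc j))) R'"
  proof (rule wp_mono[OF * order_refl])
    fix R'' assume R'': "R'' 0 = (if P j then 1 else R' 0) \<and> base N R'' \<and> agree W R' R''"
    then have "R'' i = j" using R'(3) agreeD[of W R' R'' i] i by simp
    moreover have "R'' 14 = N" "R'' 2 = 1" using R'' by (simp_all add: base_def)
    moreover have "agree (insert i W) R' R''" using R'' by (blast intro: agree_mono)
    then have "agree (insert i W) R R''" using R'(2) by (blast intro: agree_trans)
    moreover have "R'' 0 = (if \<exists>j' < Suc j. P j' then 1 else R 0)"
      using R'' R'(2) by (auto simp: less_Suc_eq)
    ultimately show "R'' i = j \<and> R'' 14 = N \<and> R'' 2 = 1 \<and> ?I (Suc j) (R''(i := Suc j, 13 := N - Suc j))"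
      using inv[of R'' "Suc j"] R'' by blast
  qed
qed

definition search_cmd :: cmd where
  "search_cmd = For 3 (For 4 (For 5 all_x_cmd))"

definition search_time :: "nat \<Rightarrow> nat" where
  "search_time N = 3 + N * (3 + N * (3 + N * (all_x_time N + 4) + 4) + 4)"

lemma wp_search_cmd:
  assumes base: "base N R" and N: "N = 4 * (M + 1)"
    and es: "es = map (input_arc w) [0..<N]" "Field (set es) \<subseteq> {..M}"
  shows "wp w search_cmd (search_time N)
    (\<lambda>R'. R' 0 = (if \<exists>a < N. \<exists>d < N. \<exists>k < N. all_x (set es) N a d k then 1 else R 0)) R"
proof -
  let ?W = "{0, 6, 7, 8, 9, 10, 11, 12, 13}"
  have k_loop: "wp w (For 5 all_x_cmd) (3 + N * (all_x_time N + 4))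
      (\<lambda>R'. R' 0 = (if \<exists>k < N. all_x (set es) N (R 3) (R 4) k then 1 else R 0) \<and>
        base N R' \<and> agree (insert 5 ?W) R R') R" if "base N R" for R
  proof (rule wp_search[OF _ _ _ _ that])
    fix j R' assume R': "base N R'" "R' 5 = j" "agree (insert 5 ?W) R R'"
    have "R' 3 = R 3" "R' 4 = R 4" using agreeD[OF R'(3)] by simp_all
    with wp_all_x_cmd[OF R'(1) N es] R'(2)
    show "wp w all_x_cmd (all_x_time N) (\<lambda>R''. R'' 0 = (if all_x (set es) N (R 3) (R 4) j then 1 else R' 0) \<and>
      base N R'' \<and> agree ?W R' R'') R'" by simp
  qed simp_all
  have d_loop: "wp w (For 4 (For 5 all_x_cmd)) (3 + N * (3 + N * (all_x_time N + 4) + 4))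
      (\<lambda>R'. R' 0 = (if \<exists>d < N. \<exists>k < N. all_x (set es) N (R 3) d k then 1 else R 0) \<and>
        base N R' \<and> agree (insert 4 (insert 5 ?W)) R R') R" if "base N R" for R
  proof (rule wp_search[OF _ _ _ _ that])
    fix j R' assume R': "base N R'" "R' 4 = j" "agree (insert 4 (insert 5 ?W)) R R'"
    have "R' 3 = R 3" using agreeD[OF R'(3)] by simp
    with k_loop[OF R'(1)] R'(2)
    show "wp w (For 5 all_x_cmd) (3 + N * (all_x_time N + 4))
      (\<lambda>R''. R'' 0 = (if \<exists>k < N. all_x (set es) N (R 3) j k then 1 else R' 0) \<and>
      base N R'' \<and> agree (insert 5 ?W) R' R'') R'" by simp
  qed simp_all
  have "wp w (For 3 (For 4 (For 5 all_x_cmd))) (search_time N)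
      (\<lambda>R'. R' 0 = (if \<exists>a < N. \<exists>d < N. \<exists>k < N. all_x (set es) N a d k then 1 else R 0) \<and>
        base N R' \<and> agree (insert 3 (insert 4 (insert 5 ?W))) R R') R"
    unfolding search_time_def
  proof (rule wp_search[OF _ _ _ _ base])
    fix j R' assume R': "base N R'" "R' 3 = j"
    with d_loop[OF R'(1)]
    show "wp w (For 4 (For 5 all_x_cmd)) (3 + N * (3 + N * (all_x_time N + 4) + 4))
      (\<lambda>R''. R'' 0 = (if \<exists>d < N. \<exists>k < N. all_x (set es) N j d k then 1 else R' 0) \<and>
      base N R'' \<and> agree (insert 4 (insert 5 ?W)) R' R'') R'" by simp
  qed simp_all
  then show ?thesis unfolding search_cmd_def by (rule wp_mono) simp_all
qed

text \<open>Registers 15 and 2 hold 0 and 1 and double as the input positions of the two counts. The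
  last two additions multiply by 4.\<close>

definition main_cmd :: cmd where
  "main_cmd = Seq (Block [Const 2 1, Read 14 15, Read 12 2, Add 14 14 12, Add 14 14 2,
     Add 14 14 14, Add 14 14 14]) search_cmd"

lemma wp_main_cmd:
  assumes w: "w = n # m # ws" and N: "N = 4 * (n + m + 1)"
    and es: "es = map (input_arc w) [0..<N]" "Field (set es) \<subseteq> {..n + m}"
  shows "wp w main_cmd (7 + search_time N)
    (\<lambda>R'. R' 0 = (if \<exists>a < N. \<exists>d < N. \<exists>k < N. all_x (set es) N a d k then 1 else 0)) (\<lambda>_. 0)"
proof -
  let ?xs = "[Const 2 1, Read 14 15, Read 12 2, Add 14 14 12, Add 14 14 2, Add 14 14 14, Add 14 14 14]"
  let ?R = "(\<lambda>_ :: nat. 0 :: nat)(2 := 1, 12 := m, 14 := N)"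
  have eff: "run_block w ?xs (\<lambda>_. 0) = ?R"
    by (simp add: w N fun_eq_iff)
  have "marks ?R = {}" by (simp add: marks_def)
  then have base: "base N ?R" by (simp add: base_def)
  show ?thesis
    unfolding main_cmd_def
  proof (rule wp_Seq[where \<Psi> = "\<lambda>R'. R' = ?R"])
    show "wp w (Block ?xs) 7 (\<lambda>R'. R' = ?R) (\<lambda>_. 0)"
      using eff by (intro wp_Block) (simp_all del: run_block_simps)
  next
    fix R' assume R': "R' = ?R"
    have zero: "?R 0 = 0" by simp
    show "wp w search_cmd (search_time N)
      (\<lambda>R'. R' 0 = (if \<exists>a < N. \<exists>d < N. \<exists>k < N. all_x (set es) N a d k then 1 else 0)) R'"
      using wp_search_cmd[OF base N es] unfolding R' zero .
  qed
qed

section \<open>Correctness on encodings\<close>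

text \<open>Any derived fact presupposes a nonempty component. This confines a, d and k to nodes
  that occur in arcs, so the search over them can be bounded.\<close>

lemma reach_avoid_start: "reach_avoid E a d k x v \<Longrightarrow> fwd E a d k \<and> bwd E a d k"
proof (induction rule: reach_avoid.induct)
  case (avoid_start v)
  have "wcomp E a d k v \<Longrightarrow> fwd E a d k \<and> bwd E a d k" for v
    by (induction rule: wcomp.induct) auto
  with avoid_start show ?case by blast
qed

lemma reach_avoid_outside:
  "reach_avoid E a d k y v \<Longrightarrow> x \<notin> Field E \<Longrightarrow> reach_avoid E a d k x v"
proof (induction rule: reach_avoid.induct)
  case (avoid_start v)
  then have "v \<noteq> x" by (auto simp: Field_def)
  with avoid_start show ?case by (blast intro: reach_avoid.avoid_start)
next
  case (avoid_step u v)
  then have "v \<noteq> x" by (auto simp: Field_def)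
  with avoid_step show ?case by (blast intro: reach_avoid.avoid_step)
next
  case (avoid_end u)
  then show ?case by (blast intro: reach_avoid.avoid_end)
qed

lemma fwd_Field: "fwd E a d v \<Longrightarrow> a \<in> Field E \<and> v \<in> Field E"
  by (induction rule: fwd.induct) (auto simp: Field_def)

lemma bwd_Field: "bwd E a d v \<Longrightarrow> d \<in> Field E \<and> v \<in> Field E"
  by (induction rule: bwd.induct) (auto simp: Field_def)

text \<open>A node x beyond N occurs in no arc, so avoiding it is no restriction, and the answer for
  x = 0 carries over.\<close>

lemma has_wheatstone_iff_all_x:
  assumes "finite E" "Field E \<subseteq> {..<N}" "0 < N"
  shows "has_wheatstone E \<longleftrightarrow> (\<exists>a < N. \<exists>d < N. \<exists>k < N. all_x E N a d k)"
  unfolding has_wheatstone_iff_reach_avoid[OF assms(1)]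
proof
  assume "\<exists>a d k. \<forall>x. reach_avoid E a d k x d"
  then obtain a d k where *: "\<And>x. reach_avoid E a d k x d" by blast
  then have "fwd E a d k" "bwd E a d k" using reach_avoid_start[of E a d k 0 d] by simp_all
  then have "a < N" "d < N" "k < N" using fwd_Field bwd_Field assms(2) by fast+
  with * show "\<exists>a < N. \<exists>d < N. \<exists>k < N. all_x E N a d k" unfolding all_x_def by blast
next
  assume "\<exists>a < N. \<exists>d < N. \<exists>k < N. all_x E N a d k"
  then obtain a d k where *: "\<And>x. x < N \<Longrightarrow> reach_avoid E a d k x d" unfolding all_x_def by blast
  have "reach_avoid E a d k x d" for x
  proof (cases "x < N")
    case False
    then have "x \<notin> Field E" using assms(2) by auto
    then show ?thesis using reach_avoid_outside[OF *[OF assms(3)]] by blast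
  qed (rule *)
  then show "\<exists>a d k. \<forall>x. reach_avoid E a d k x d" by blast
qed

lemma nth_concat_pairs:
  "j < length es \<Longrightarrow> concat (map (\<lambda>e. [f e, g e]) es) ! (2 * j) = f (es ! j) \<and>
    concat (map (\<lambda>e. [f e, g e]) es) ! (2 * j + 1) = g (es ! j)"
proof (induction es arbitrary: j)
  case (Cons e es)
  then show ?case by (cases j) simp_all
qed simp

lemma length_concat_pairs: "length (concat (map (\<lambda>e. [f e, g e]) es)) = 2 * length es"
  by (induction es) simp_all

text \<open>Reading beyond the end of the input yields the loop \<open>(0, 0)\<close>, which is harmless.\<close>
lemma input_arcs:
  assumes w: "w = n # length es # concat (map (\<lambda>e. [f e, g e]) es)" and "length es < N"
  shows "set (map (input_arc w) [0..<N]) = insert (0, 0) ((\<lambda>e. (f e, g e)) ` set es)"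
proof -
  have len: "length w = 2 * length es + 2" by (simp add: w length_concat_pairs)
  have inside: "input_arc w j = (f (es ! j), g (es ! j))" if "j < length es" for j
    using nth_concat_pairs[OF that, of f g] that len
    by (simp add: input_arc_def input_def w nth_Cons' numeral_eq_Suc)
  have outside: "input_arc w j = (0, 0)" if "length es \<le> j" for j
    using that len by (simp add: input_arc_def input_def)
  have "{0..<N} = {..<length es} \<union> {length es..<N}" using assms(2) by auto
  then have "input_arc w ` {0..<N} = input_arc w ` {..<length es} \<union> input_arc w ` {length es..<N}"
    by (simp add: image_Un)
  also have "input_arc w ` {..<length es} = (\<lambda>j. (f (es ! j), g (es ! j))) ` {..<length es}"
    using inside by (intro image_cong) simp_all
  also have "\<dots> = (\<lambda>e. (f e, g e)) ` set es"
    by (auto simp: set_conv_nth image_iff)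
  also have "input_arc w ` {length es..<N} = {(0, 0)}"
    using outside assms(2) by (auto simp: image_iff)
  finally show ?thesis by simp
qed

theorem main_cmd_correct:
  fixes G :: "(nat, nat) pre_digraph"
  assumes "fin_digraph G" "w \<in> digraph_encodings G"
  shows "wp w main_cmd (7 + search_time (4 * (digraph_size G + 1)))
    (\<lambda>R. R 0 = (if contains_wheatstone G then 1 else 0)) (\<lambda>_. 0)"
proof -
  interpret fin_digraph G by (rule assms(1))
  obtain \<nu> es where w: "w = card (verts G) # card (arcs G) # concat (map (\<lambda>e. [\<nu> (tail G e), \<nu> (head G e)]) es)"
    and \<nu>: "bij_betw \<nu> (verts G) {..<card (verts G)}" and es: "distinct es" "set es = arcs G"
    using assms(2) by (auto simp: digraph_encodings_def)
  define M where "M = card (verts G) + card (arcs G)"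
  define N where "N = 4 * (M + 1)"
  have m: "card (arcs G) = length es" using es distinct_card by fastforce
  define E where "E = set (map (input_arc w) [0..<N])"
  have "length es < N" by (simp add: N_def M_def m)
  then have "E = insert (0, 0) ((\<lambda>e. (\<nu> (tail G e), \<nu> (head G e))) ` arcs G)"
    unfolding E_def using input_arcs[OF w[unfolded m]] es by simp
  also have "(\<lambda>e. (\<nu> (tail G e), \<nu> (head G e))) ` arcs G = map_prod \<nu> \<nu> ` arcs_ends G"
    by (auto simp: arcs_ends_def arc_to_ends_def image_image)
  finally have E: "E = insert (0, 0) (map_prod \<nu> \<nu> ` arcs_ends G)" .
  have F: "Field (arcs_ends G) \<subseteq> verts G"
    by (auto simp: Field_def arcs_ends_def arc_to_ends_def)
  \<comment> \<open>Node 0 enters through the padding arc even if the graph is empty. The closed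
    bound \<open>{..M}\<close>, and with it the summand 1 in N, leaves room for it.\<close>
  have "Field E = {0} \<union> \<nu> ` Field (arcs_ends G)"
    unfolding E Field_insert Field_map_prod_image by simp
  also have "\<dots> \<subseteq> {0} \<union> {..<card (verts G)}"
    using F \<nu> unfolding bij_betw_def by blast
  also have "\<dots> \<subseteq> {..M}" unfolding M_def by auto
  finally have FE: "Field E \<subseteq> {..M}" .
  have "inj_on \<nu> (Field (arcs_ends G))"
    using \<nu> F by (auto simp: bij_betw_def intro: inj_on_subset)
  then have "has_wheatstone E \<longleftrightarrow> has_wheatstone (arcs_ends G)"
    unfolding E has_wheatstone_insert_loop by (rule has_wheatstone_image_iff)
  also have "\<dots> \<longleftrightarrow> contains_wheatstone G"
    using has_wheatstone_imp_contains contains_imp_has_wheatstone by blast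
  finally have "has_wheatstone E \<longleftrightarrow> contains_wheatstone G" .
  moreover have "has_wheatstone E \<longleftrightarrow> (\<exists>a < N. \<exists>d < N. \<exists>k < N. all_x E N a d k)"
    using FE by (intro has_wheatstone_iff_all_x) (auto simp: E_def N_def)
  ultimately show ?thesis
    using wp_main_cmd[OF w, of N, OF _ refl] FE
    unfolding digraph_size_def M_def[symmetric] N_def[symmetric] E_def[symmetric] by (simp add: N_def M_def)
qed

lemma wp_run:
  assumes "wp w c T \<Phi> (\<lambda>_. 0)"
  obtains t where "t \<le> T" "halted (compile 0 c) (run (compile 0 c) w t)"
    "\<Phi> (snd (run (compile 0 c) w t))"
proof -
  obtain n R' where n: "exec w c (\<lambda>_. 0) n R'" "n \<le> T" "\<Phi> R'" using assms by (auto simp: wp_def)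
  have "code_at (compile 0 c) 0 (compile 0 c)" by (auto simp: code_at_def)
  from compile_correct[OF n(1) this] have "run (compile 0 c) w n = (code_len c, R')"
    by (simp add: run_def)
  with n show ?thesis by (intro that[of n]) (simp_all add: halted_def)
qed

text \<open>Six nested loops of length N, over a, d, k, x, passes and arcs, make the degree 6. The
  coefficient list \<open>[:4, 4:]\<close> is N as a polynomial in the size.\<close>

lemma search_time_poly: "\<exists>p :: nat poly. \<forall>s. poly p s = 7 + search_time (4 * (s + 1))"
proof -
  let ?N = "[:4, 4:] :: nat poly"
  let ?pass = "3 + ?N * [:arc_time + 4:]"
  let ?closure = "3 + ?N * 7 + (3 + ?N * (?pass + 4))"
  let ?all = "1 + (3 + ?N * (?closure + 8 + 4) + 2)"
  have "poly (7 + (3 + ?N * (3 + ?N * (3 + ?N * (?all + 4) + 4) + 4))) s = 7 + search_time (4 * (s + 1))" for s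
    by (simp add: search_time_def all_x_time_def closure_time_def pass_time_def algebra_simps)
  then show ?thesis by blast
qed

theorem corollary5p4:
  shows "decidable_in_poly_time {G :: (nat, nat) pre_digraph. fin_digraph G}
           digraph_size digraph_encodings contains_wheatstone"
proof -
  obtain p :: "nat poly" where p: "\<forall>s. poly p s = 7 + search_time (4 * (s + 1))"
    using search_time_poly by blast
  show ?thesis
    unfolding decidable_in_poly_time_def
  proof (intro exI[of _ "compile 0 main_cmd"] exI[of _ p] ballI)
    fix G :: "(nat, nat) pre_digraph" and w
    assume "G \<in> {G. fin_digraph G}" "w \<in> digraph_encodings G"
    then have "wp w main_cmd (poly p (digraph_size G))
        (\<lambda>R. R 0 = (if contains_wheatstone G then 1 else 0)) (\<lambda>_. 0)"
      using main_cmd_correct p by simp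
    then show "\<exists>t \<le> poly p (digraph_size G). halted (compile 0 main_cmd) (run (compile 0 main_cmd) w t) \<and>
        snd (run (compile 0 main_cmd) w t) 0 = (if contains_wheatstone G then 1 else 0)"
      by (rule wp_run) blast
  qed
qed

end
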